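(* Let $X$ be a hyperelliptic curve (smooth, projective, over $\mathbb{C}$) of genus $g\geq 3$. Then the rank of the second Gaussian map $\mu_2:I_2(K_X)\to H^0(X,4K_X)$ is $2g-5$.
   Context: $K_X$ is the canonical bundle, $nK_X=K_X^{\otimes n}$, and $I_2(K_X)$ is the kernel of the multiplication map $S^2H^0(X,K_X)\to H^0(X,2K_X)$. Second Gaussian map $\mu_2:I_2(K_X)\to H^0(X,4K_X)$: fix a basis $\{\omega_i\}$ of $H^0(X,K_X)$, with $\omega_i=f_i(z)\,dz$ in a local coordinate $z$. For $Q=\sum_{i,j}a_{ij}\,\omega_i\otimes\omega_j\in I_2(K_X)$ with $a_{ij}=a_{ji}$, one sets locally $\mu_2(Q)=\sum_{i,j}a_{ij}f_i''f_j\,(dz)^4=-\sum_{i,j}a_{ij}f_i'f_j'\,(dz)^4$; this is a well-defined global section of $4K_X$. *)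

theory Defs
  imports "HOL-Complex_Analysis.Complex_Analysis" "HOL-Library.Function_Algebras"
begin

section \<open>Riemann surfaces and holomorphic maps\<close>

text \<open>
  A smooth projective curve over the complex numbers is treated through its associated compact
  connected Riemann surface, given by a topology together with a holomorphic atlas, which need not
  be maximal.  A chart is a pair of its domain and its coordinate function; the values of the
  coordinate function outside the domain are irrelevant.
\<close>

type_synonym 'a chart = "'a set \<times> ('a \<Rightarrow> complex)"

definition transition :: "'a chart \<Rightarrow> 'a chart \<Rightarrow> complex \<Rightarrow> complex" where
  "transition c d = snd d \<circ> inv_into (fst c) (snd c)"

definition chart_on :: "'a topology \<Rightarrow> 'a chart \<Rightarrow> bool" where
  "chart_on X c \<longleftrightarrow> openin X (fst c) \<and> open (snd c ` fst c) \<and>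
     homeomorphic_map (subtopology X (fst c)) (top_of_set (snd c ` fst c)) (snd c)"

definition holomorphic_atlas :: "'a topology \<Rightarrow> 'a chart set \<Rightarrow> bool" where
  "holomorphic_atlas X A \<longleftrightarrow> (\<forall>c\<in>A. chart_on X c) \<and> (\<Union>c\<in>A. fst c) = topspace X \<and>
     (\<forall>c\<in>A. \<forall>d\<in>A. transition c d holomorphic_on snd c ` (fst c \<inter> fst d))"

definition compact_riemann_surface :: "'a topology \<Rightarrow> 'a chart set \<Rightarrow> bool" where
  "compact_riemann_surface X A \<longleftrightarrow> topspace X \<noteq> {} \<and> Hausdorff_space X \<and> connected_space X \<and>
     compact_space X \<and> holomorphic_atlas X A"

definition holomorphic_map ::
    "'a topology \<Rightarrow> 'a chart set \<Rightarrow> 'b topology \<Rightarrow> 'b chart set \<Rightarrow> ('a \<Rightarrow> 'b) \<Rightarrow> bool" where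
  "holomorphic_map X A Y B F \<longleftrightarrow> continuous_map X Y F \<and>
     (\<forall>c\<in>A. \<forall>d\<in>B. (snd d \<circ> F \<circ> inv_into (fst c) (snd c))
        holomorphic_on snd c ` {p \<in> fst c. F p \<in> fst d})"

definition chart_at :: "'a chart set \<Rightarrow> 'a \<Rightarrow> 'a chart" where
  "chart_at A p = (SOME c. c \<in> A \<and> p \<in> fst c)"

text \<open>
  The multiplicity of a holomorphic map at a point: the vanishing order of its local expression
  minus the value there.  It does not depend on the charts around the point and its image.
\<close>

definition multiplicity_at ::
    "'a chart set \<Rightarrow> 'b chart set \<Rightarrow> ('a \<Rightarrow> 'b) \<Rightarrow> 'a \<Rightarrow> int" where
  "multiplicity_at A B F p =
     (let c = chart_at A p; d = chart_at B (F p)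
      in zorder (\<lambda>z. snd d (F (inv_into (fst c) (snd c) z)) - snd d (F p)) (snd c p))"

text \<open>
  Every fibre is finite and has the same number of points, counted with multiplicity.  The
  finiteness clause also excludes constant maps.
\<close>

definition has_degree ::
    "'a topology \<Rightarrow> 'a chart set \<Rightarrow> 'b topology \<Rightarrow> 'b chart set \<Rightarrow> ('a \<Rightarrow> 'b) \<Rightarrow> nat \<Rightarrow> bool" where
  "has_degree X A Y B F n \<longleftrightarrow>
     (\<forall>q\<in>topspace Y. finite {p \<in> topspace X. F p = q} \<and>
        (\<Sum>p | p \<in> topspace X \<and> F p = q. multiplicity_at A B F p) = int n)"

text \<open>
  The projective line as the one-point compactification of the complex plane, with \<open>None\<close> as the
  point at infinity and the coordinates $z$ and $1/z$.
\<close>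

definition P1_top :: "complex option topology" where
  "P1_top = Alexandroff_compactification euclidean"

definition P1_atlas :: "complex option chart set" where
  "P1_atlas = {(range Some, the),
     (- {Some 0}, \<lambda>p. case p of None \<Rightarrow> 0 | Some z \<Rightarrow> 1 / z)}"

section \<open>Sections of powers of the canonical bundle\<close>

text \<open>
  A section of \<open>n K\<close> is given by its local expressions \<open>f(z) (dz)\<^sup>n\<close>, one coefficient function for
  each chart of the atlas.  The coefficient functions are required to vanish off the image of the
  chart, and to be zero for pairs that are not charts of the atlas, so that sections that agree
  on the surface are equal as functions.
\<close>

type_synonym 'a diff_section = "'a chart \<Rightarrow> complex \<Rightarrow> complex"

definition H0 :: "'a chart set \<Rightarrow> nat \<Rightarrow> 'a diff_section set" where
  "H0 A n = {s.
     (\<forall>c\<in>A. s c holomorphic_on snd c ` fst c) \<and>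
     (\<forall>c z. c \<notin> A \<or> z \<notin> snd c ` fst c \<longrightarrow> s c z = 0) \<and>
     (\<forall>c\<in>A. \<forall>d\<in>A. \<forall>p\<in>fst c \<inter> fst d.
        s c (snd c p) = s d (snd d p) * deriv (transition c d) (snd c p) ^ n)}"

definition scale_section :: "complex \<Rightarrow> 'a diff_section \<Rightarrow> 'a diff_section" where
  "scale_section a s = (\<lambda>c z. a * s c z)"

global_interpretation sections: vector_space "scale_section :: complex \<Rightarrow> 'a diff_section \<Rightarrow> _"
  by standard (auto simp: scale_section_def fun_eq_iff algebra_simps)

lemma sections_subspace_H0: "sections.subspace (H0 A n)"
proof (rule sections.subspaceI)
  show "0 \<in> H0 A n" by (auto simp: H0_def zero_fun_def)
next
  fix s t :: "'a diff_section" assume s: "s \<in> H0 A n" and t: "t \<in> H0 A n"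
  have "(s + t) c = (\<lambda>z. s c z + t c z)" for c by (simp add: fun_eq_iff)
  then have "(s + t) c holomorphic_on snd c ` fst c" if "c \<in> A" for c
    using s t that by (auto simp only: H0_def mem_Collect_eq intro: holomorphic_on_add)
  moreover have "(s + t) c (snd c p) = (s + t) d (snd d p) * deriv (transition c d) (snd c p) ^ n"
    if "c \<in> A" "d \<in> A" "p \<in> fst c \<inter> fst d" for c d p
  proof -
    have "s c (snd c p) = s d (snd d p) * deriv (transition c d) (snd c p) ^ n"
      "t c (snd c p) = t d (snd d p) * deriv (transition c d) (snd c p) ^ n"
      using s t that unfolding H0_def by blast+
    then show ?thesis by (simp only: plus_fun_apply distrib_right)
  qed
  moreover have "(s + t) c z = 0" if "c \<notin> A \<or> z \<notin> snd c ` fst c" for c z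
  proof -
    have "s c z = 0" "t c z = 0" using s t that unfolding H0_def by blast+
    then show ?thesis by simp
  qed
  ultimately show "s + t \<in> H0 A n" unfolding H0_def by blast
next
  fix a and s :: "'a diff_section" assume s: "s \<in> H0 A n"
  have "scale_section a s c holomorphic_on snd c ` fst c" if "c \<in> A" for c
  proof -
    have "s c holomorphic_on snd c ` fst c" using s that unfolding H0_def by blast
    then show ?thesis unfolding scale_section_def by (intro holomorphic_intros)
  qed
  moreover have "scale_section a s c (snd c p)
      = scale_section a s d (snd d p) * deriv (transition c d) (snd c p) ^ n"
    if "c \<in> A" "d \<in> A" "p \<in> fst c \<inter> fst d" for c d p
  proof -
    have "s c (snd c p) = s d (snd d p) * deriv (transition c d) (snd c p) ^ n"
      using s that unfolding H0_def by blast
    then show ?thesis by (simp only: scale_section_def mult.assoc)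
  qed
  moreover have "scale_section a s c z = 0" if "c \<notin> A \<or> z \<notin> snd c ` fst c" for c z
  proof -
    have "s c z = 0" using s that unfolding H0_def by blast
    then show ?thesis by (simp add: scale_section_def)
  qed
  ultimately show "scale_section a s \<in> H0 A n" unfolding H0_def by blast
qed

definition genus :: "'a chart set \<Rightarrow> nat" where
  "genus A = sections.dim (H0 A 1)"

definition hyperelliptic :: "'a topology \<Rightarrow> 'a chart set \<Rightarrow> bool" where
  "hyperelliptic X A \<longleftrightarrow> compact_riemann_surface X A \<and> genus A \<ge> 2 \<and>
     (\<exists>F. holomorphic_map X A P1_top P1_atlas F \<and> has_degree X A P1_top P1_atlas F 2)"

definition canonical_basis :: "'a chart set \<Rightarrow> nat \<Rightarrow> (nat \<Rightarrow> 'a diff_section) \<Rightarrow> bool" where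
  "canonical_basis A g \<omega> \<longleftrightarrow> inj_on \<omega> {..<g} \<and> sections.independent (\<omega> ` {..<g}) \<and>
     sections.span (\<omega> ` {..<g}) = H0 A 1"

section \<open>The second Gaussian map\<close>

text \<open>
  With respect to a basis of length \<open>g\<close>, the symmetric square of the space of holomorphic
  differentials is the space of symmetric \<open>g \<times> g\<close> matrices \<open>a\<close>, where \<open>a\<close> stands for the symmetric
  tensor $\sum_{i,j} a_{ij}\, \omega_i \otimes \omega_j$.
\<close>

definition sym2 :: "nat \<Rightarrow> (nat \<Rightarrow> nat \<Rightarrow> complex) set" where
  "sym2 g = {a. (\<forall>i j. a i j = a j i) \<and> (\<forall>i j. i \<ge> g \<or> j \<ge> g \<longrightarrow> a i j = 0)}"

definition multiplication_map ::
    "nat \<Rightarrow> (nat \<Rightarrow> 'a diff_section) \<Rightarrow> (nat \<Rightarrow> nat \<Rightarrow> complex) \<Rightarrow> 'a diff_section" where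
  "multiplication_map g \<omega> a = (\<lambda>c z. \<Sum>i<g. \<Sum>j<g. a i j * \<omega> i c z * \<omega> j c z)"

definition I2 :: "nat \<Rightarrow> (nat \<Rightarrow> 'a diff_section) \<Rightarrow> (nat \<Rightarrow> nat \<Rightarrow> complex) set" where
  "I2 g \<omega> = {a \<in> sym2 g. multiplication_map g \<omega> a = 0}"

definition mu2 ::
    "'a chart set \<Rightarrow> nat \<Rightarrow> (nat \<Rightarrow> 'a diff_section) \<Rightarrow> (nat \<Rightarrow> nat \<Rightarrow> complex) \<Rightarrow> 'a diff_section"
  where
  "mu2 A g \<omega> a = (\<lambda>c z. if c \<in> A \<and> z \<in> snd c ` fst c
     then \<Sum>i<g. \<Sum>j<g. a i j * deriv (deriv (\<omega> i c)) z * \<omega> j c z else 0)"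

text \<open>
  The two local formulas for the second Gaussian map agree, and they define a section of \<open>4 K\<close>.
\<close>

lemma I2_local:
  fixes A :: "'a chart set"
  assumes atl: "holomorphic_atlas X A" and \<omega>: "\<And>i. i < g \<Longrightarrow> \<omega> i \<in> H0 A 1"
    and a: "a \<in> I2 g \<omega>" and c: "c \<in> A" and z: "z \<in> snd c ` fst c"
  shows "(\<Sum>i<g. \<Sum>j<g. a i j * \<omega> i c z * \<omega> j c z) = 0"
    and "(\<Sum>i<g. \<Sum>j<g. a i j * deriv (\<omega> i c) z * \<omega> j c z) = 0"
    and "(\<Sum>i<g. \<Sum>j<g. a i j * deriv (deriv (\<omega> i c)) z * \<omega> j c z)
       = - (\<Sum>i<g. \<Sum>j<g. a i j * deriv (\<omega> i c) z * deriv (\<omega> j c) z)"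
proof -
  define S where "S = snd c ` fst c"
  have S: "open S" using atl c by (auto simp: holomorphic_atlas_def chart_on_def S_def)
  have hol: "\<omega> i c holomorphic_on S" if "i < g" for i
    using \<omega>[OF that] c by (auto simp: H0_def S_def)
  have d1: "(\<omega> i c has_field_derivative deriv (\<omega> i c) w) (at w)" if "i < g" "w \<in> S" for i w
    using hol[OF that(1)] S that(2) by (metis holomorphic_derivI)
  have d2: "(deriv (\<omega> i c) has_field_derivative deriv (deriv (\<omega> i c)) w) (at w)"
    if "i < g" "w \<in> S" for i w
    using holomorphic_deriv[OF hol[OF that(1)] S] S that(2) by (metis holomorphic_derivI)
  have sym: "a i j = a j i" for i j using a by (auto simp: I2_def sym2_def)
  show q0: "(\<Sum>i<g. \<Sum>j<g. a i j * \<omega> i c z * \<omega> j c z) = 0" for z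
  proof -
    have "multiplication_map g \<omega> a c z = 0" using a by (simp add: I2_def)
    then show ?thesis by (simp add: multiplication_map_def)
  qed
  have q1: "(\<Sum>i<g. \<Sum>j<g. a i j * deriv (\<omega> i c) w * \<omega> j c w) = 0" if w: "w \<in> S" for w
  proof -
    have "((\<lambda>z. \<Sum>i<g. \<Sum>j<g. a i j * \<omega> i c z * \<omega> j c z) has_field_derivative
       (\<Sum>i<g. \<Sum>j<g. a i j * deriv (\<omega> i c) w * \<omega> j c w
          + a i j * \<omega> i c w * deriv (\<omega> j c) w)) (at w)"
      by (intro DERIV_sum) (auto intro!: derivative_eq_intros d1 w simp: algebra_simps)
    then have "(\<Sum>i<g. \<Sum>j<g. a i j * deriv (\<omega> i c) w * \<omega> j c w
          + a i j * \<omega> i c w * deriv (\<omega> j c) w) = 0"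
      using DERIV_unique[OF _ DERIV_const[of 0]] by (simp add: q0)
    moreover have "(\<Sum>i<g. \<Sum>j<g. a i j * \<omega> i c w * deriv (\<omega> j c) w)
        = (\<Sum>i<g. \<Sum>j<g. a i j * deriv (\<omega> i c) w * \<omega> j c w)"
      by (subst sum.swap) (simp add: sym mult_ac)
    ultimately show ?thesis by (simp add: sum.distrib)
  qed
  then show "(\<Sum>i<g. \<Sum>j<g. a i j * deriv (\<omega> i c) z * \<omega> j c z) = 0"
    using z by (simp add: S_def)
  have "((\<lambda>z. \<Sum>i<g. \<Sum>j<g. a i j * deriv (\<omega> i c) z * \<omega> j c z) has_field_derivative
     (\<Sum>i<g. \<Sum>j<g. a i j * deriv (deriv (\<omega> i c)) z * \<omega> j c z
        + a i j * deriv (\<omega> i c) z * deriv (\<omega> j c) z)) (at z)"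
    by (intro DERIV_sum)
      (auto intro!: derivative_eq_intros d1 d2 z[folded S_def] simp: algebra_simps)
  moreover have "((\<lambda>z. \<Sum>i<g. \<Sum>j<g. a i j * deriv (\<omega> i c) z * \<omega> j c z)
      has_field_derivative 0) (at z)"
    by (rule has_field_derivative_transform_within_open[OF DERIV_const S z[folded S_def]])
      (simp add: q1)
  ultimately have "(\<Sum>i<g. \<Sum>j<g. a i j * deriv (deriv (\<omega> i c)) z * \<omega> j c z
        + a i j * deriv (\<omega> i c) z * deriv (\<omega> j c) z) = 0"
    by (rule DERIV_unique)
  then show "(\<Sum>i<g. \<Sum>j<g. a i j * deriv (deriv (\<omega> i c)) z * \<omega> j c z)
       = - (\<Sum>i<g. \<Sum>j<g. a i j * deriv (\<omega> i c) z * deriv (\<omega> j c) z)"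
    by (simp add: sum.distrib add_eq_0_iff2)
qed

lemma mu2_eq_first_derivatives:
  assumes "holomorphic_atlas X A" "\<And>i. i < g \<Longrightarrow> \<omega> i \<in> H0 A 1" "a \<in> I2 g \<omega>"
    and "c \<in> A" "z \<in> snd c ` fst c"
  shows "mu2 A g \<omega> a c z = - (\<Sum>i<g. \<Sum>j<g. a i j * deriv (\<omega> i c) z * deriv (\<omega> j c) z)"
  using I2_local(3)[OF assms] assms by (simp add: mu2_def)

lemma open_chart_image:
  assumes atl: "holomorphic_atlas X A" and c: "c \<in> A" and d: "d \<in> A"
  shows "open (snd c ` (fst c \<inter> fst d))"
proof -
  have "openin X (fst c)" "openin X (fst d)" "open (snd c ` fst c)"
    and h: "homeomorphic_map (subtopology X (fst c)) (top_of_set (snd c ` fst c)) (snd c)"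
    using assms by (auto simp: holomorphic_atlas_def chart_on_def)
  then have "openin (subtopology X (fst c)) (fst c \<inter> fst d)"
    by (metis openin_Int openin_subtopology_Int2 inf_commute)
  then have "openin (top_of_set (snd c ` fst c)) (snd c ` (fst c \<inter> fst d))"
    using h by (meson homeomorphic_imp_open_map open_map_def)
  then show ?thesis using \<open>open (snd c ` fst c)\<close> by (metis openin_open_trans)
qed

lemma mu2_in_H0:
  fixes A :: "'a chart set"
  assumes atl: "holomorphic_atlas X A" and \<omega>: "\<And>i. i < g \<Longrightarrow> \<omega> i \<in> H0 A 1"
    and a: "a \<in> I2 g \<omega>"
  shows "mu2 A g \<omega> a \<in> H0 A 4"
proof -
  have hol: "mu2 A g \<omega> a c holomorphic_on snd c ` fst c" if c: "c \<in> A" for c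
  proof -
    have S: "open (snd c ` fst c)" using atl c by (auto simp: holomorphic_atlas_def chart_on_def)
    have "\<omega> i c holomorphic_on snd c ` fst c" if "i < g" for i
      using \<omega>[OF that] c by (auto simp: H0_def)
    then have "(\<lambda>z. \<Sum>i<g. \<Sum>j<g. a i j * deriv (deriv (\<omega> i c)) z * \<omega> j c z)
        holomorphic_on snd c ` fst c"
      by (intro holomorphic_intros holomorphic_deriv S) auto
    then show ?thesis
      by (rule holomorphic_transform) (simp add: mu2_def c)
  qed
  have vanish: "mu2 A g \<omega> a c z = 0" if "c \<notin> A \<or> z \<notin> snd c ` fst c" for c z
    using that by (auto simp: mu2_def)
  have transform: "mu2 A g \<omega> a c (snd c p)
      = mu2 A g \<omega> a d (snd d p) * deriv (transition c d) (snd c p) ^ 4"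
    if c: "c \<in> A" and d: "d \<in> A" and p: "p \<in> fst c \<inter> fst d" for c d p
  proof -
    define D where "D = snd c ` (fst c \<inter> fst d)"
    define T where "T = transition c d"
    define z where "z = snd c p"
    have D: "open D" using open_chart_image[OF atl c d] by (simp add: D_def)
    have Thol: "T holomorphic_on D" using atl c d by (simp add: holomorphic_atlas_def T_def D_def)
    have inj: "inj_on (snd c) (fst c)"
    proof -
      have "fst c \<subseteq> topspace X"
        using atl c by (auto simp: holomorphic_atlas_def chart_on_def dest: openin_subset)
      then show ?thesis
        using atl c by (auto simp: holomorphic_atlas_def chart_on_def homeomorphic_map_def
          quotient_map_def Int_absorb1 dest!: homeomorphic_imp_injective_map)
    qed
    have Tq: "T (snd c q) = snd d q" if "q \<in> fst c" for q
      using inj that by (simp add: T_def transition_def)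
    have zD: "z \<in> D" using p by (auto simp: z_def D_def)
    have TD: "T w \<in> snd d ` fst d" if "w \<in> D" for w using that Tq by (auto simp: D_def)
    have Sd: "open (snd d ` fst d)" using atl d by (auto simp: holomorphic_atlas_def chart_on_def)
    have tr: "\<omega> i c w = \<omega> i d (T w) * deriv T w" if "i < g" "w \<in> D" for i w
    proof -
      obtain q where q: "q \<in> fst c \<inter> fst d" "w = snd c q" using \<open>w \<in> D\<close> by (auto simp: D_def)
      have "\<omega> i c (snd c q) = \<omega> i d (snd d q) * deriv (transition c d) (snd c q) ^ 1"
        using \<omega>[OF that(1)] c d q(1) unfolding H0_def by blast
      then show ?thesis using q Tq by (simp add: T_def)
    qed
    define h where "h = (\<lambda>i. \<omega> i d (T z))"
    define h' where "h' = (\<lambda>i. deriv (\<omega> i d) (T z))"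
    define t where "t = deriv T z"
    define u where "u = deriv (deriv T) z"
    have f': "deriv (\<omega> i c) z = h' i * t ^ 2 + h i * u" if i: "i < g" for i
    proof -
      have "(\<omega> i d has_field_derivative h' i) (at (T z))"
        using \<omega>[OF i] d TD[OF zD] Sd unfolding H0_def h'_def
        by (metis (no_types, lifting) holomorphic_derivI mem_Collect_eq)
      moreover have "(T has_field_derivative t) (at z)"
        using Thol D zD unfolding t_def by (metis holomorphic_derivI)
      ultimately have 1: "((\<lambda>w. \<omega> i d (T w)) has_field_derivative h' i * t) (at z)"
        by (rule DERIV_chain2)
      have 2: "(deriv T has_field_derivative u) (at z)"
        using holomorphic_deriv[OF Thol D] D zD unfolding u_def by (metis holomorphic_derivI)
      have "((\<lambda>w. \<omega> i d (T w) * deriv T w) has_field_derivative h' i * t ^ 2 + h i * u) (at z)"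
        using DERIV_mult[OF 1 2] by (simp add: h_def t_def power2_eq_square algebra_simps)
      then have "(\<omega> i c has_field_derivative h' i * t ^ 2 + h i * u) (at z)"
        by (rule has_field_derivative_transform_within_open[OF _ D zD]) (simp add: tr i)
      then show ?thesis by (rule DERIV_imp_deriv)
    qed
    have sym: "a i j = a j i" for i j using a by (auto simp: I2_def sym2_def)
    note loc = I2_local[OF atl \<omega> a d TD[OF zD], folded h_def h'_def]
    have loc0: "(\<Sum>i<g. \<Sum>j<g. a i j * h i * h j) = 0" using loc(1) by (simp add: h_def)
    have loc1: "(\<Sum>i<g. \<Sum>j<g. a i j * h' i * h j) = 0" using loc(2) by (simp add: h_def h'_def)
    have loc1': "(\<Sum>i<g. \<Sum>j<g. a i j * h i * h' j) = 0"
      using loc1 by (subst sum.swap) (simp add: sym mult_ac)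
    have "(\<Sum>i<g. \<Sum>j<g. a i j * deriv (\<omega> i c) z * deriv (\<omega> j c) z)
       = (\<Sum>i<g. \<Sum>j<g. a i j * (h' i * t ^ 2 + h i * u) * (h' j * t ^ 2 + h j * u))"
      by (intro sum.cong refl) (simp add: f')
    also have "\<dots> = (\<Sum>i<g. \<Sum>j<g. t ^ 4 * (a i j * h' i * h' j) + t ^ 2 * u * (a i j * h' i * h j)
       + t ^ 2 * u * (a i j * h i * h' j) + u ^ 2 * (a i j * h i * h j))"
      by (intro sum.cong refl) (simp add: algebra_simps power2_eq_square power4_eq_xxxx)
    also have "\<dots> = t ^ 4 * (\<Sum>i<g. \<Sum>j<g. a i j * h' i * h' j)"
      by (simp add: sum.distrib loc0 loc1 loc1' flip: sum_distrib_left)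
    finally have "mu2 A g \<omega> a c z = mu2 A g \<omega> a d (T z) * t ^ 4"
      using mu2_eq_first_derivatives[OF atl \<omega> a c, of z]
        mu2_eq_first_derivatives[OF atl \<omega> a d TD[OF zD]] p
      by (simp add: z_def h'_def)
    then show ?thesis using Tq p by (simp add: z_def t_def T_def)
  qed
  show ?thesis
    unfolding H0_def using hol transform vanish by blast
qed

end

theory Submission
  imports Defs
begin

text \<open>
Let $F : X \to \mathbb{P}^1$ be the double covering.  The whole theorem rests on the shape of the
space of holomorphic differentials: there are a differential \<open>\<eta>\<^sub>0\<close> and a rational function \<open>T\<close> of
\<open>F\<close> such that \<open>\<eta>\<^sub>0, T \<eta>\<^sub>0, \<dots>, T\<^bsup>g-1\<^esup> \<eta>\<^sub>0\<close> is a basis.  In other words, the canonical map is the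
covering \<open>F\<close> followed by the embedding of the line as a rational normal curve.

To find this basis, one shows that the trace of a holomorphic differential \<open>s\<close> vanishes
(\<open>trace_zero\<close>).  The sum of \<open>s/dF\<close> over the fibre of a variable value \<open>w\<close> is holomorphic away from
the finitely many branch values, has removable singularities there, and tends to zero at infinity,
so that it is zero by Liouville's theorem.  Hence, over a value \<open>q\<close> that is not a branch value, a
differential that vanishes at one of the two points of the fibre vanishes at the other one too, and
can then be multiplied by \<open>T = 1/(F - q)\<close> without acquiring a pole (\<open>divide_section\<close>).  The
condition that \<open>T\<^bsup>m\<^esup> s\<close> be holomorphic thus costs only one linear condition more than the same
condition on \<open>T\<^bsup>m-1\<^esup> s\<close>, so \<open>g - 1\<close> conditions on a space of dimension \<open>g\<close> leave a nonzero
\<open>\<eta>\<^sub>0\<close> for which all of \<open>T\<^bsup>i\<^esup> \<eta>\<^sub>0\<close> with \<open>i < g\<close> are holomorphic (\<open>exists_multiple\<close>).  They are linearly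
independent because \<open>T\<close> takes infinitely many values, and there are \<open>g\<close> of them.

The image of the second Gaussian map is the same for all bases (\<open>mu2_image_subset\<close>), so it can be
computed in the basis \<open>T\<^bsup>i\<^esup> \<eta>\<^sub>0\<close>.  A symmetric matrix \<open>a\<close> is a quadric containing the curve if and only
if the sum of its entries over each diagonal \<open>i + j = k\<close> is zero.  For such a matrix the derivatives
of \<open>\<eta>\<^sub>0\<close> drop out of the local formula and
$$\mu_2(a) = - (T' \eta_0)^2 \sum_k \Bigl( \sum_{i+j=k} i j\, a_{ij} \Bigr) T^{k-2}$$
(\<open>mu2_eta\<close>).  The coefficient at \<open>k\<close> vanishes for \<open>k < 2\<close> and for \<open>k > 2g - 4\<close>, where the product \<open>ij\<close>
is constant on the diagonal; and for \<open>2 \<le> k \<le> 2g - 4\<close> a single quadric of rank at most four has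
this coefficient nonzero and all the other ones zero.  So the \<open>2g - 5\<close> sections
\<open>(T' \<eta>\<^sub>0)\<^sup>2 T\<^bsup>k-2\<^esup>\<close> form a basis of the image.
\<close>

section \<open>Holomorphic functions of one variable\<close>

lemma zorder_simple_zero:
  assumes "f holomorphic_on S" "open S" "z \<in> S" "f z = 0" "deriv f z \<noteq> 0"
  shows "zorder f z = 1"
  by (rule zorder_zero_eqI[OF assms(1-3)]) (use assms in auto)

text \<open>
Writing \<open>f z = (z - \<xi>)\<^sup>n g z\<close> with \<open>g \<xi> \<noteq> 0\<close> turns \<open>f / f'\<close> into \<open>(z - \<xi>) g / (n g + (z - \<xi>) g')\<close>.  It
controls \<open>s / dF\<close> for a differential \<open>s\<close> at a ramification point, where \<open>dF\<close> is zero.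
\<close>

lemma holomorphic_log_derivative_limit:
  assumes hol: "f holomorphic_on S" and S: "open S" "connected S" "\<xi> \<in> S"
    and f0: "f \<xi> = 0" and nz: "w \<in> S" "f w \<noteq> 0"
  shows "\<forall>\<^sub>F z in at \<xi>. deriv f z \<noteq> 0"
    and "((\<lambda>z. f z / deriv f z) \<longlongrightarrow> 0) (at \<xi>)"
proof -
  have "\<not> f constant_on S" using S f0 nz unfolding constant_on_def by metis
  then obtain g r n where n: "0 < n" and r: "0 < r" "ball \<xi> r \<subseteq> S"
    and g: "g holomorphic_on ball \<xi> r"
    and fg: "\<And>z. z \<in> ball \<xi> r \<Longrightarrow> f z = (z - \<xi>) ^ n * g z"
    and gnz: "\<And>z. z \<in> ball \<xi> r \<Longrightarrow> g z \<noteq> 0"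
    using holomorphic_factor_zero_nonconstant[OF hol S f0] by metis
  \<comment> \<open>The derivative of \<open>f\<close> is \<open>(z - \<xi>)\<^bsup>n-1\<^esup> v z\<close>.\<close>
  define v where "v = (\<lambda>z. of_nat n * g z + (z - \<xi>) * deriv g z)"
  have cont: "continuous_on (ball \<xi> r) v" "continuous_on (ball \<xi> r) g"
    unfolding v_def by (intro continuous_intros holomorphic_on_imp_continuous_on
        holomorphic_deriv g open_ball)+
  have lim: "(v \<longlongrightarrow> v \<xi>) (at \<xi>)" "(g \<longlongrightarrow> g \<xi>) (at \<xi>)"
    using cont r(1) by (simp_all add: continuous_on_eq_continuous_at isCont_def)
  have v0: "v \<xi> \<noteq> 0" using n gnz[of \<xi>] r by (simp add: v_def)
  have evv: "\<forall>\<^sub>F z in at \<xi>. v z \<noteq> 0"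
    using tendsto_imp_eventually_ne[OF lim(1) v0] .
  have evb: "\<forall>\<^sub>F z in at \<xi>. z \<in> ball \<xi> r - {\<xi>}"
    using r(1) by (intro eventually_at_in_open) auto
  have df: "deriv f z = (z - \<xi>) ^ (n - 1) * v z" if z: "z \<in> ball \<xi> r" for z
  proof -
    have "(g has_field_derivative deriv g z) (at z)"
      using g z by (metis holomorphic_derivI open_ball)
    then have "((\<lambda>z. (z - \<xi>) ^ n * g z) has_field_derivative
        of_nat n * (z - \<xi>) ^ (n - 1) * g z + deriv g z * (z - \<xi>) ^ n) (at z)"
      by (auto intro!: derivative_eq_intros)
    then have "(f has_field_derivative
        of_nat n * (z - \<xi>) ^ (n - 1) * g z + deriv g z * (z - \<xi>) ^ n) (at z)"
      by (rule has_field_derivative_transform_within_open[OF _ open_ball z]) (simp add: fg)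
    then have "deriv f z = of_nat n * (z - \<xi>) ^ (n - 1) * g z + deriv g z * (z - \<xi>) ^ n"
      by (rule DERIV_imp_deriv)
    then show ?thesis using n by (cases n) (simp_all add: v_def algebra_simps)
  qed
  show "\<forall>\<^sub>F z in at \<xi>. deriv f z \<noteq> 0"
    using evv evb by eventually_elim (simp add: df)
  have "((\<lambda>z. (z - \<xi>) * g z / v z) \<longlongrightarrow> (\<xi> - \<xi>) * g \<xi> / v \<xi>) (at \<xi>)"
    by (intro tendsto_intros lim v0)
  then have "((\<lambda>z. (z - \<xi>) * g z / v z) \<longlongrightarrow> 0) (at \<xi>)" by simp
  moreover have "\<forall>\<^sub>F z in at \<xi>. (z - \<xi>) * g z / v z = f z / deriv f z"
    using evv evb
  proof eventually_elim
    case (elim z)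
    then show ?case using n by (cases n) (auto simp: df fg)
  qed
  ultimately show "((\<lambda>z. f z / deriv f z) \<longlongrightarrow> 0) (at \<xi>)" by (rule Lim_transform_eventually)
qed

text \<open>
A quotient whose denominator has simple zeros only, at each of which the numerator vanishes as
well, is extended by the value given by l'Hopital's rule.
\<close>

lemma holomorphic_quotient_simple_zero:
  assumes f: "f holomorphic_on S" and g: "g holomorphic_on S" and S: "open S"
    and zeros: "\<And>z. z \<in> S \<Longrightarrow> g z = 0 \<Longrightarrow> f z = 0 \<and> deriv g z \<noteq> 0"
  shows "(\<lambda>z. if g z = 0 then deriv f z / deriv g z else f z / g z) holomorphic_on S"
proof -
  let ?h = "\<lambda>z. if g z = 0 then deriv f z / deriv g z else f z / g z"
  have "?h analytic_on {z}" if z: "z \<in> S" for z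
  proof (cases "g z = 0")
    case False
    have "continuous_on S g" using g by (rule holomorphic_on_imp_continuous_on)
    then have "open (S \<inter> g -` (- {0}))" using S by (intro continuous_open_preimage) auto
    moreover have "(\<lambda>z. f z / g z) holomorphic_on (S \<inter> g -` (- {0}))"
      by (intro holomorphic_on_divide holomorphic_on_subset[OF f] holomorphic_on_subset[OF g]) auto
    then have "?h holomorphic_on (S \<inter> g -` (- {0}))"
      by (rule holomorphic_transform) auto
    ultimately show ?thesis using z False by (auto simp: analytic_at)
  next
    case True
    obtain r where r: "r > 0" "ball z r \<subseteq> S" "inj_on g (ball z r)"
      using has_complex_derivative_locally_injective[OF g z S] zeros[OF z True] by blast
    have gnz: "g w \<noteq> 0" if "w \<in> ball z r - {z}" for w
      using that r True by (metis DiffD1 DiffD2 centre_in_ball inj_onD insertI1)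
    have sub: "ball z r - {z} \<subseteq> S" using r by auto
    have off: "?h holomorphic_on ball z r - {z}"
      by (rule holomorphic_transform[of "\<lambda>w. f w / g w"])
        (use gnz in \<open>auto intro!: holomorphic_on_divide holomorphic_on_subset[OF f sub]
            holomorphic_on_subset[OF g sub]\<close>)
    have "((\<lambda>w. (f w - f z) / (w - z)) \<longlongrightarrow> deriv f z) (at z)"
      "((\<lambda>w. (g w - g z) / (w - z)) \<longlongrightarrow> deriv g z) (at z)"
      using f g S z by (metis holomorphic_derivI has_field_derivative_iff)+
    then have "((\<lambda>w. ((f w - f z) / (w - z)) / ((g w - g z) / (w - z)))
        \<longlongrightarrow> deriv f z / deriv g z) (at z)"
      using zeros[OF z True] by (intro tendsto_divide) auto
    moreover have "\<forall>\<^sub>F w in at z. w \<in> ball z r - {z}"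
      using r(1) by (intro eventually_at_in_open) auto
    then have "\<forall>\<^sub>F w in at z. ((f w - f z) / (w - z)) / ((g w - g z) / (w - z)) = ?h w"
      by eventually_elim (use gnz zeros[OF z True] True in auto)
    ultimately have "(?h \<longlongrightarrow> ?h z) (at z)"
      using True by (auto intro: Lim_transform_eventually)
    then have "isCont ?h z" by (simp add: isCont_def)
    moreover have "isCont ?h w" if "w \<in> ball z r - {z}" for w
      using holomorphic_on_imp_continuous_on[OF off] that
      by (simp add: continuous_on_eq_continuous_at open_delete)
    ultimately have "continuous_on (ball z r) ?h"
      by (intro continuous_at_imp_continuous_on ballI) (metis Diff_iff empty_iff insert_iff)
    from no_isolated_singularity[OF this off] have "?h holomorphic_on ball z r" by simp
    then show ?thesis
      unfolding analytic_at using r(1) by (intro exI[of _ "ball z r"]) simp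
  qed
  then have "?h analytic_on S" using analytic_on_analytic_at by blast
  then show ?thesis by (rule analytic_imp_holomorphic)
qed

lemma continuous_eq_off_finite:
  fixes f g :: "complex \<Rightarrow> complex"
  assumes S: "open S" and f: "continuous_on S f" and g: "continuous_on S g" and K: "finite K"
    and eq: "\<And>z. z \<in> S - K \<Longrightarrow> f z = g z" and z: "z \<in> S"
  shows "f z = g z"
proof -
  have "(f \<longlongrightarrow> f z) (at z)" "(g \<longlongrightarrow> g z) (at z)"
    using f g S z by (simp_all add: continuous_on_eq_continuous_at isCont_def)
  moreover have "\<forall>\<^sub>F w in at z. w \<in> S - (K - {z}) - {z}"
    using S K z by (intro eventually_at_in_open) (auto intro: open_Diff finite_imp_closed)
  then have "\<forall>\<^sub>F w in at z. f w = g w" by eventually_elim (auto intro: eq)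
  ultimately show ?thesis by (metis Lim_transform_eventually tendsto_unique at_neq_bot)
qed

lemma eventually_at_infinity_notin:
  fixes K :: "'b :: real_normed_vector set"
  assumes "bounded K"
  shows "\<forall>\<^sub>F z in at_infinity. z \<notin> K"
proof -
  obtain r where r: "\<And>z. z \<in> K \<Longrightarrow> norm z \<le> r" using assms by (meson bounded_iff)
  have "\<forall>\<^sub>F z :: 'b in at_infinity. r + 1 \<le> norm z"
    by (auto simp: eventually_at_infinity)
  then show ?thesis by eventually_elim (use r in fastforce)
qed

text \<open>
The singularities are removed one at a time; Liouville's theorem then applies to an entire function
that tends to zero at infinity.
\<close>

lemma holomorphic_off_finite_eq_zero:
  fixes h :: "complex \<Rightarrow> complex"
  assumes "finite B" "h holomorphic_on - B"
    and "\<And>b. b \<in> B \<Longrightarrow> ((\<lambda>w. (w - b) * h w) \<longlongrightarrow> 0) (at b)"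
    and "(h \<longlongrightarrow> 0) at_infinity" and "w \<notin> B"
  shows "h w = 0"
  using assms
proof (induction B arbitrary: h w rule: finite_induct)
  case empty
  then show ?case using Liouville_weak_0[of h] by simp
next
  case (insert b B)
  have op: "open (- B)" using insert.hyps(1) by (simp add: finite_imp_closed open_Compl)
  have eq: "- B - {b} = - insert b B" by auto
  have "\<exists>g. g holomorphic_on - B \<and> (\<forall>z \<in> - B - {b}. g z = h z)"
    by (subst holomorphic_on_extend_lim)
      (use insert op eq in \<open>auto simp: interior_open\<close>)
  then obtain g where g: "g holomorphic_on - B" "\<And>z. z \<in> - B - {b} \<Longrightarrow> g z = h z" by blast
  have "\<forall>\<^sub>F z in at_infinity. z \<notin> insert b B"
    using insert.hyps(1) by (intro eventually_at_infinity_notin) (simp add: finite_imp_bounded)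
  then have "\<forall>\<^sub>F z in at_infinity. h z = g z" by eventually_elim (simp add: g(2))
  with insert.prems(3) have ginf: "(g \<longlongrightarrow> 0) at_infinity" by (rule Lim_transform_eventually)
  have "((\<lambda>z. (z - a) * g z) \<longlongrightarrow> 0) (at a)" if a: "a \<in> B" for a
  proof -
    have "finite (insert b B - {a})" using insert.hyps(1) by simp
    then have "open (- (insert b B - {a}))" by (intro open_Compl finite_imp_closed)
    then have "\<forall>\<^sub>F z in at a. z \<in> - (insert b B - {a}) - {a}"
      by (intro eventually_at_in_open) auto
    then have "\<forall>\<^sub>F z in at a. (z - a) * h z = (z - a) * g z"
      by eventually_elim (simp add: g(2))
    with insert.prems(2)[of a] a show ?thesis by (auto intro: Lim_transform_eventually)
  qed
  then have "g w = 0" using insert.IH[OF g(1) _ ginf] insert.prems by blast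
  then show ?case using g(2)[of w] insert.prems by auto
qed

lemma holomorphic_local_inverse:
  assumes f: "f holomorphic_on S" and S: "open S" "\<xi> \<in> S" and nz: "deriv f \<xi> \<noteq> 0"
  obtains W g where "open W" "f \<xi> \<in> W" "g holomorphic_on W"
    "\<And>w. w \<in> W \<Longrightarrow> g w \<in> S \<and> f (g w) = w \<and> deriv f (g w) \<noteq> 0"
proof -
  obtain r where r: "r > 0" "ball \<xi> r \<subseteq> S" "inj_on f (ball \<xi> r)" "open (f ` ball \<xi> r)"
    using has_complex_derivative_locally_invertible[OF f S(2,1) nz] by metis
  have fb: "f holomorphic_on ball \<xi> r" using f r(2) by (rule holomorphic_on_subset)
  obtain g where g: "g holomorphic_on (f ` ball \<xi> r)"
    "\<And>z. z \<in> ball \<xi> r \<Longrightarrow> deriv f z * deriv g (f z) = 1"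
    "\<And>z. z \<in> ball \<xi> r \<Longrightarrow> g (f z) = z"
    using holomorphic_has_inverse[OF fb open_ball r(3)] by metis
  show ?thesis
  proof (rule that[OF r(4) _ g(1)])
    show "f \<xi> \<in> f ` ball \<xi> r" using r(1) by auto
    fix w assume "w \<in> f ` ball \<xi> r"
    then obtain z where z: "z \<in> ball \<xi> r" "w = f z" by auto
    show "g w \<in> S \<and> f (g w) = w \<and> deriv f (g w) \<noteq> 0"
      using g(2,3)[OF z(1)] z r(2) by auto
  qed
qed

section \<open>Charts of a Riemann surface\<close>

definition chart_inv :: "'a chart \<Rightarrow> complex \<Rightarrow> 'a" where
  "chart_inv c = inv_into (fst c) (snd c)"

locale surface_atlas =
  fixes X :: "'a topology" and A :: "'a chart set"
  assumes atlas: "holomorphic_atlas X A"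
begin

lemma chart_on: "c \<in> A \<Longrightarrow> chart_on X c"
  using atlas by (simp add: holomorphic_atlas_def)

lemma chart_openin: "c \<in> A \<Longrightarrow> openin X (fst c)"
  using chart_on by (simp add: chart_on_def)

lemma chart_subset: "c \<in> A \<Longrightarrow> p \<in> fst c \<Longrightarrow> p \<in> topspace X"
  using openin_subset[OF chart_openin] by blast

lemma open_chart_range: "c \<in> A \<Longrightarrow> open (snd c ` fst c)"
  using chart_on by (simp add: chart_on_def)

lemma chart_homeomorphic:
  "c \<in> A \<Longrightarrow> homeomorphic_map (subtopology X (fst c)) (top_of_set (snd c ` fst c)) (snd c)"
  using chart_on by (simp add: chart_on_def)

lemma chart_inj: "c \<in> A \<Longrightarrow> inj_on (snd c) (fst c)"
  using homeomorphic_imp_injective_map[OF chart_homeomorphic] chart_openin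
  by (metis inf.absorb2 openin_subset topspace_subtopology)

lemma chart_inv_left: "c \<in> A \<Longrightarrow> p \<in> fst c \<Longrightarrow> chart_inv c (snd c p) = p"
  by (simp add: chart_inv_def chart_inj)

lemma chart_inv_in: "z \<in> snd c ` fst c \<Longrightarrow> chart_inv c z \<in> fst c"
  and chart_inv_right: "z \<in> snd c ` fst c \<Longrightarrow> snd c (chart_inv c z) = z"
  by (simp_all add: chart_inv_def inv_into_into f_inv_into_f)

lemma open_chart_of_openin:
  assumes c: "c \<in> A" and U: "openin X U"
  shows "open (snd c ` (fst c \<inter> U))"
proof -
  have "openin (subtopology X (fst c)) (fst c \<inter> U)"
    using U by (simp add: openin_subtopology_Int2)
  then have "openin (top_of_set (snd c ` fst c)) (snd c ` (fst c \<inter> U))"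
    using chart_homeomorphic[OF c] by (meson homeomorphic_imp_open_map open_map_def)
  then show ?thesis using open_chart_range[OF c] by (metis openin_open_trans)
qed

lemma openin_chart_preimage:
  assumes c: "c \<in> A" and D: "open D"
  shows "openin X {p \<in> fst c. snd c p \<in> D}"
proof -
  have "openin (top_of_set (snd c ` fst c)) (snd c ` fst c \<inter> D)"
    using D by (simp add: openin_open_Int)
  then have "openin (subtopology X (fst c))
      {p \<in> topspace (subtopology X (fst c)). snd c p \<in> snd c ` fst c \<inter> D}"
    using homeomorphic_imp_continuous_map[OF chart_homeomorphic[OF c]]
    by (rule openin_continuous_map_preimage[rotated])
  moreover have "{p \<in> topspace (subtopology X (fst c)). snd c p \<in> snd c ` fst c \<inter> D}
      = {p \<in> fst c. snd c p \<in> D}"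
    using chart_subset[OF c] by auto
  ultimately have "openin (subtopology X (fst c)) {p \<in> fst c. snd c p \<in> D}" by simp
  then show ?thesis using chart_openin[OF c] by (rule openin_trans_full)
qed

lemma chart_at_in: "p \<in> topspace X \<Longrightarrow> chart_at A p \<in> A"
  and chart_at_mem: "p \<in> topspace X \<Longrightarrow> p \<in> fst (chart_at A p)"
proof -
  assume "p \<in> topspace X"
  then have "p \<in> (\<Union>c\<in>A. fst c)" using atlas by (simp add: holomorphic_atlas_def)
  then have "\<exists>c. c \<in> A \<and> p \<in> fst c" by blast
  then have "chart_at A p \<in> A \<and> p \<in> fst (chart_at A p)"
    unfolding chart_at_def by (rule someI_ex)
  then show "chart_at A p \<in> A" "p \<in> fst (chart_at A p)" by auto
qed

lemma eventually_at_chart: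
  assumes c: "c \<in> A" and p: "p \<in> fst c" and ev: "\<forall>\<^sub>F z in at (snd c p). P (chart_inv c z)"
  obtains N where "openin X N" "p \<in> N" "\<And>x. x \<in> N - {p} \<Longrightarrow> P x"
proof -
  obtain D where D: "open D" "snd c p \<in> D" "\<And>z. z \<in> D \<Longrightarrow> z \<noteq> snd c p \<Longrightarrow> P (chart_inv c z)"
    using ev unfolding eventually_at_topological by auto
  show ?thesis
  proof (rule that)
    show "openin X {x \<in> fst c. snd c x \<in> D}" by (rule openin_chart_preimage[OF c D(1)])
    show "p \<in> {x \<in> fst c. snd c x \<in> D}" using p D by simp
    fix x assume "x \<in> {x \<in> fst c. snd c x \<in> D} - {p}"
    then show "P x" using D(3)[of "snd c x"] chart_inj[OF c] p
      by (auto simp: chart_inv_left[OF c] inj_on_eq_iff)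
  qed
qed

lemma transition_apply:
  "c \<in> A \<Longrightarrow> p \<in> fst c \<Longrightarrow> transition c d (snd c p) = snd d p"
  using chart_inv_left by (simp add: transition_def chart_inv_def)

lemma transition_derivative:
  assumes c: "c \<in> A" and d: "d \<in> A" and p: "p \<in> fst c" "p \<in> fst d"
  shows "(transition c d has_field_derivative deriv (transition c d) (snd c p)) (at (snd c p))"
proof (rule holomorphic_derivI)
  show "transition c d holomorphic_on snd c ` (fst c \<inter> fst d)"
    using atlas c d by (simp add: holomorphic_atlas_def)
qed (use p open_chart_image[OF atlas c d] in auto)

lemma derivative_change_chart:
  assumes c: "c \<in> A" and d: "d \<in> A" and p: "p \<in> fst c" "p \<in> fst d"
    and f: "((f \<circ> chart_inv d) has_field_derivative D) (at (snd d p))"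
  shows "((f \<circ> chart_inv c) has_field_derivative D * deriv (transition c d) (snd c p)) (at (snd c p))"
proof -
  have "((f \<circ> chart_inv d) has_field_derivative D) (at (transition c d (snd c p)))"
    using f by (simp add: transition_apply[OF c p(1)])
  then have "((\<lambda>z. (f \<circ> chart_inv d) (transition c d z)) has_field_derivative
      D * deriv (transition c d) (snd c p)) (at (snd c p))"
    using transition_derivative[OF c d p] by (rule DERIV_chain2)
  then show ?thesis
  proof (rule has_field_derivative_transform_within_open)
    show "open (snd c ` (fst c \<inter> fst d))" by (rule open_chart_image[OF atlas c d])
  qed (use p in \<open>auto simp: transition_apply[OF c] chart_inv_left c d\<close>)
qed

text \<open>
The chain rule for the two opposite transitions, whose composition is the identity.
\<close>

lemma deriv_transition_nonzero:
  assumes c: "c \<in> A" and d: "d \<in> A" and p: "p \<in> fst c" "p \<in> fst d"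
  shows "deriv (transition c d) (snd c p) \<noteq> 0"
proof -
  have "((snd c \<circ> chart_inv c) has_field_derivative 1) (at (snd c p))"
    by (rule has_field_derivative_transform_within_open[OF DERIV_ident open_chart_range[OF c]])
      (use p in \<open>auto simp: chart_inv_left c\<close>)
  then have "((snd c \<circ> chart_inv d) has_field_derivative deriv (transition d c) (snd d p))
      (at (snd d p))"
    using derivative_change_chart[OF d c p(2,1), of "snd c" 1] by simp
  from derivative_change_chart[OF c d p this]
  have "((snd c \<circ> chart_inv c) has_field_derivative
      deriv (transition d c) (snd d p) * deriv (transition c d) (snd c p)) (at (snd c p))" .
  with \<open>((snd c \<circ> chart_inv c) has_field_derivative 1) (at (snd c p))\<close>
  have "deriv (transition d c) (snd d p) * deriv (transition c d) (snd c p) = 1"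
    by (metis DERIV_unique)
  then show ?thesis by auto
qed

lemma section_holomorphic: "s \<in> H0 A n \<Longrightarrow> c \<in> A \<Longrightarrow> s c holomorphic_on snd c ` fst c"
  by (auto simp: H0_def)

lemma section_change_chart:
  assumes "s \<in> H0 A 1" "c \<in> A" "d \<in> A" "p \<in> fst c" "p \<in> fst d"
  shows "s c (snd c p) = s d (snd d p) * deriv (transition c d) (snd c p)"
proof -
  have "s c (snd c p) = s d (snd d p) * deriv (transition c d) (snd c p) ^ 1"
    using assms unfolding H0_def by blast
  then show ?thesis by simp
qed

end

section \<open>Double coverings of the projective line\<close>

locale double_cover = surface_atlas X A for X :: "'a topology" and A +
  fixes F :: "'a \<Rightarrow> complex option"
  assumes compact: "compact_space X" and Hausdorff: "Hausdorff_space X"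
    and F_hol: "holomorphic_map X A P1_top P1_atlas F"
    and F_deg: "has_degree X A P1_top P1_atlas F 2"
begin

text \<open>
The covering in the coordinates \<open>z\<close> and \<open>1/z\<close> of the line.  The value of \<open>phi\<close> at the points over
infinity is arbitrary, as is the value of \<open>psi\<close> over zero, where the default \<open>1 / 0 = 0\<close> is taken.
\<close>

definition phi :: "'a \<Rightarrow> complex" where "phi p = the (F p)"

definition psi :: "'a \<Rightarrow> complex" where
  "psi p = (case F p of None \<Rightarrow> 0 | Some z \<Rightarrow> 1 / z)"

definition fibre :: "complex \<Rightarrow> 'a set" where "fibre b = {p \<in> topspace X. F p = Some b}"

definition dphi :: "'a chart \<Rightarrow> 'a \<Rightarrow> complex" where
  "dphi c p = deriv (phi \<circ> chart_inv c) (snd c p)"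

text \<open>
A point is regular if it lies over a finite value and is not a ramification point.  The reference
chart is the one that the multiplicity uses, but the notion is the same in every chart, see
\<open>regular_iff\<close>.
\<close>

definition regular :: "'a \<Rightarrow> bool" where
  "regular p \<longleftrightarrow> p \<in> topspace X \<and> F p \<noteq> None \<and> dphi (chart_at A p) p \<noteq> 0"

lemma topspace_P1: "topspace P1_top = UNIV"
proof -
  have "z \<in> topspace P1_top" for z
    by (cases z) (auto simp: P1_top_def)
  then show ?thesis by auto
qed

lemma openin_P1_Some: "open U \<Longrightarrow> openin P1_top (Some ` U)"
  by (simp add: P1_top_def)

lemma openin_P1_delete: "openin P1_top (- {Some b})"
proof -
  have "- {Some b} = insert None (Some ` (topspace euclidean - {b}))"
    by (auto simp: image_iff)
  moreover have "compactin euclidean {b}" "closedin euclidean {b}" by simp_all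
  ultimately show ?thesis
    unfolding P1_top_def openin_Alexandroff_compactification by blast
qed

lemma F_continuous: "continuous_map X P1_top F"
  using F_hol by (simp add: holomorphic_map_def)

lemma F_chart:
  assumes "c \<in> A" "d \<in> P1_atlas"
  shows "(snd d \<circ> F \<circ> chart_inv c) holomorphic_on snd c ` {p \<in> fst c. F p \<in> fst d}"
  using F_hol assms by (simp add: holomorphic_map_def chart_inv_def)

lemma openin_preimage: "openin P1_top U \<Longrightarrow> openin X {p \<in> topspace X. F p \<in> U}"
  using F_continuous by (rule openin_continuous_map_preimage)

lemma openin_finite_part: "openin X {p \<in> topspace X. F p \<noteq> None}"
proof -
  have "{p \<in> topspace X. F p \<noteq> None} = {p \<in> topspace X. F p \<in> Some ` UNIV}"
    by (auto simp: image_iff)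
  then show ?thesis using openin_preimage[OF openin_P1_Some[OF open_UNIV]] by simp
qed

lemma openin_off_fibre: "openin X {p \<in> topspace X. F p \<noteq> Some b}"
  using openin_preimage[OF openin_P1_delete] by simp

lemma phi_holomorphic:
  assumes c: "c \<in> A"
  shows "(phi \<circ> chart_inv c) holomorphic_on snd c ` {p \<in> fst c. F p \<noteq> None}"
proof -
  have "(range Some, the) \<in> P1_atlas" by (simp add: P1_atlas_def)
  then have "(the \<circ> F \<circ> chart_inv c) holomorphic_on snd c ` {p \<in> fst c. F p \<in> range Some}"
    using F_chart[OF c] by (metis fst_conv snd_conv)
  moreover have "{p \<in> fst c. F p \<in> range Some} = {p \<in> fst c. F p \<noteq> None}"
    by (auto simp: image_iff)
  ultimately show ?thesis by (simp add: phi_def comp_def)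
qed

lemma psi_holomorphic:
  assumes c: "c \<in> A"
  shows "(psi \<circ> chart_inv c) holomorphic_on snd c ` {p \<in> fst c. F p \<noteq> Some 0}"
proof -
  have "(- {Some 0}, \<lambda>p. case p of None \<Rightarrow> 0 | Some z \<Rightarrow> 1 / z) \<in> P1_atlas"
    by (simp add: P1_atlas_def)
  then have "((\<lambda>p. case p of None \<Rightarrow> 0 | Some z \<Rightarrow> 1 / z) \<circ> F \<circ> chart_inv c)
      holomorphic_on snd c ` {p \<in> fst c. F p \<in> - {Some 0}}"
    using F_chart[OF c] by (metis fst_conv snd_conv)
  then show ?thesis by (simp add: psi_def comp_def)
qed

lemma open_chart_part:
  assumes c: "c \<in> A" and U: "openin X {p \<in> topspace X. P p}"
  shows "open (snd c ` {p \<in> fst c. P p})"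
proof -
  have "{p \<in> fst c. P p} = fst c \<inter> {p \<in> topspace X. P p}" using chart_subset[OF c] by auto
  then show ?thesis using open_chart_of_openin[OF c U] by simp
qed

lemma open_finite_part: "c \<in> A \<Longrightarrow> open (snd c ` {p \<in> fst c. F p \<noteq> None})"
  by (intro open_chart_part openin_finite_part)

lemma open_off_fibre: "c \<in> A \<Longrightarrow> open (snd c ` {p \<in> fst c. F p \<noteq> Some b})"
  by (intro open_chart_part openin_off_fibre)

lemma phi_derivative:
  assumes c: "c \<in> A" and p: "p \<in> fst c" "F p \<noteq> None"
  shows "((phi \<circ> chart_inv c) has_field_derivative dphi c p) (at (snd c p))"
  unfolding dphi_def
  by (rule holomorphic_derivI[OF phi_holomorphic[OF c] open_finite_part[OF c]]) (use p in auto)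

lemma dphi_change_chart:
  assumes "c \<in> A" "d \<in> A" "p \<in> fst c" "p \<in> fst d" "F p \<noteq> None"
  shows "dphi c p = dphi d p * deriv (transition c d) (snd c p)"
  using derivative_change_chart[OF assms(1-4) phi_derivative[OF assms(2,4,5)]]
  unfolding dphi_def by (rule DERIV_imp_deriv)

lemma regular_iff:
  assumes c: "c \<in> A" and p: "p \<in> fst c"
  shows "regular p \<longleftrightarrow> F p \<noteq> None \<and> dphi c p \<noteq> 0"
proof -
  have pX: "p \<in> topspace X" using chart_subset[OF c p] .
  note d = chart_at_in[OF pX] chart_at_mem[OF pX]
  show ?thesis
    using dphi_change_chart[OF c d(1) p d(2)] deriv_transition_nonzero[OF c d(1) p d(2)] pX
    by (auto simp: regular_def)
qed

text \<open>
The chart of the line in which the multiplicity is computed may be either of the two, unless the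
value is zero; in both, the local expression has a simple zero.
\<close>

lemma multiplicity_regular:
  assumes p: "regular p"
  shows "multiplicity_at A P1_atlas F p = 1"
proof -
  define c where "c = chart_at A p"
  have pX: "p \<in> topspace X" using p by (simp add: regular_def)
  have c: "c \<in> A" "p \<in> fst c" using pX chart_at_in chart_at_mem by (auto simp: c_def)
  obtain w where w: "F p = Some w" using p by (auto simp: regular_def)
  have nz: "dphi c p \<noteq> 0" using p by (simp add: regular_def c_def)
  define d where "d = chart_at P1_atlas (F p)"
  have "\<exists>d. d \<in> P1_atlas \<and> F p \<in> fst d"
    by (rule exI[of _ "(range Some, the)"]) (simp add: P1_atlas_def w)
  then have d: "d \<in> P1_atlas" "F p \<in> fst d"
    unfolding d_def chart_at_def by (metis (mono_tags, lifting) someI_ex)+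
  note der = phi_derivative[OF c, unfolded w, simplified]
  let ?S = "snd c ` {x \<in> fst c. F x \<noteq> None}"
  have S: "open ?S" "snd c p \<in> ?S" using open_finite_part[OF c(1)] c(2) w by auto
  have "zorder (\<lambda>z. snd d (F (chart_inv c z)) - snd d (F p)) (snd c p) = 1"
  proof (cases "d = (range Some, the)")
    case True
    have e: "(\<lambda>z. snd d (F (chart_inv c z)) - snd d (F p)) = (\<lambda>z. (phi \<circ> chart_inv c) z - w)"
      by (simp add: True phi_def w fun_eq_iff)
    have "((\<lambda>z. (phi \<circ> chart_inv c) z - w) has_field_derivative dphi c p) (at (snd c p))"
      using der unfolding comp_def by (auto intro!: derivative_eq_intros)
    then have "deriv (\<lambda>z. (phi \<circ> chart_inv c) z - w) (snd c p) = dphi c p"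
      by (rule DERIV_imp_deriv)
    moreover have "(\<lambda>z. (phi \<circ> chart_inv c) z - w) holomorphic_on ?S"
      by (intro holomorphic_intros phi_holomorphic c)
    ultimately show ?thesis unfolding e
      by (intro zorder_simple_zero[OF _ S]) (use nz w in \<open>auto simp: phi_def chart_inv_left c\<close>)
  next
    case False
    then have d': "d = (- {Some 0}, \<lambda>p. case p of None \<Rightarrow> 0 | Some z \<Rightarrow> 1 / z)"
      using d by (simp add: P1_atlas_def)
    then have w0: "w \<noteq> 0" using d w by simp
    let ?S' = "snd c ` {x \<in> fst c. F x \<noteq> Some 0}"
    have S': "open ?S'" "snd c p \<in> ?S'" using open_off_fibre[OF c(1)] c(2) w w0 by auto
    let ?u = "\<lambda>z. (psi \<circ> chart_inv c) z - 1 / w"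
    have e: "(\<lambda>z. snd d (F (chart_inv c z)) - snd d (F p)) = ?u"
      by (simp add: d' psi_def w fun_eq_iff)
    have "((\<lambda>z. 1 / (phi \<circ> chart_inv c) z - 1 / w) has_field_derivative
        - dphi c p / w ^ 2) (at (snd c p))"
    proof -
      have "phi (chart_inv c (snd c p)) = w" by (simp add: phi_def chart_inv_left c w)
      then show ?thesis using der w0 unfolding comp_def
        by (auto intro!: derivative_eq_intros simp: power2_eq_square)
    qed
    then have "(?u has_field_derivative - dphi c p / w ^ 2) (at (snd c p))"
    proof (rule has_field_derivative_transform_within_open[OF _ S])
      fix z assume "z \<in> ?S"
      then show "1 / (phi \<circ> chart_inv c) z - 1 / w = ?u z"
        by (auto simp: phi_def psi_def chart_inv_left c)
    qed
    then have "deriv ?u (snd c p) = - dphi c p / w ^ 2"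
      by (rule DERIV_imp_deriv)
    moreover have "?u holomorphic_on ?S'"
      by (intro holomorphic_intros psi_holomorphic c)
    ultimately show ?thesis unfolding e
      by (intro zorder_simple_zero[OF _ S']) (use nz w w0 in \<open>auto simp: psi_def chart_inv_left c\<close>)
  qed
  then show ?thesis
    by (simp add: multiplicity_at_def Let_def c_def[symmetric] d_def[symmetric] chart_inv_def)
qed

lemma finite_fibre: "finite {p \<in> topspace X. F p = q}"
  using F_deg by (simp add: has_degree_def topspace_P1)

lemma finite_fibre_Some: "finite (fibre b)"
  using finite_fibre by (simp add: fibre_def)

lemma card_regular_fibre:
  assumes "\<And>p. p \<in> fibre b \<Longrightarrow> regular p"
  shows "card (fibre b) = 2"
proof -
  have "(\<Sum>p\<in>fibre b. multiplicity_at A P1_atlas F p) = 2"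
    using F_deg by (simp add: has_degree_def topspace_P1 fibre_def)
  moreover have "(\<Sum>p\<in>fibre b. multiplicity_at A P1_atlas F p) = (\<Sum>p\<in>fibre b. 1)"
    by (intro sum.cong refl multiplicity_regular assms)
  ultimately show ?thesis by simp
qed

text \<open>
A continuous map from a compact space to a Hausdorff space is closed, hence the image of the complement
of \<open>N\<close> is a closed set that misses \<open>q\<close>.
\<close>

lemma fibre_neighbourhood:
  assumes N: "openin X N" and q: "\<And>p. p \<in> topspace X \<Longrightarrow> F p = q \<Longrightarrow> p \<in> N"
  shows "\<exists>V. openin P1_top V \<and> q \<in> V \<and> (\<forall>p\<in>topspace X. F p \<in> V \<longrightarrow> p \<in> N)"
proof -
  have "Hausdorff_space P1_top"
    unfolding P1_top_def
    by (simp add: Hausdorff_space_Alexandroff_compactification locally_compact_space_euclidean)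
  then have "closed_map X P1_top F"
    using compact F_continuous by (metis continuous_imp_closed_map)
  then have "closedin P1_top (F ` (topspace X - N))"
    using N by (simp add: closed_map_def closedin_diff)
  then show ?thesis
    using q by (intro exI[of _ "- F ` (topspace X - N)"])
      (auto simp: closedin_def topspace_P1 Compl_eq_Diff_UNIV)
qed

text \<open>
Otherwise \<open>D\<close>, an infinite set, would lie in a finite union of fibres, each of which is finite.
\<close>

lemma infinite_values:
  assumes c: "c \<in> A" and D: "open D" "D \<noteq> {}" "D \<subseteq> snd c ` fst c"
  shows "infinite (F ` chart_inv c ` D)"
proof
  assume fin: "finite (F ` chart_inv c ` D)"
  have "chart_inv c ` D \<subseteq> (\<Union>q\<in>F ` chart_inv c ` D. {p \<in> topspace X. F p = q})"
  proof
    fix p assume p: "p \<in> chart_inv c ` D"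
    then have "p \<in> topspace X"
      using D(3) chart_inv_in chart_subset[OF c] by (metis (no_types, opaque_lifting) imageE subsetD)
    with p show "p \<in> (\<Union>q\<in>F ` chart_inv c ` D. {p \<in> topspace X. F p = q})" by auto
  qed
  moreover have "finite (\<Union>q\<in>F ` chart_inv c ` D. {p \<in> topspace X. F p = q})"
    by (rule finite_UN_I[OF fin finite_fibre])
  ultimately have "finite (chart_inv c ` D)" by (rule finite_subset)
  moreover have "inj_on (chart_inv c) D"
    by (intro inj_on_inverseI[of _ "snd c"] chart_inv_right) (use D(3) in blast)
  ultimately have "finite D" by (simp add: finite_image_iff)
  then show False using D(1,2) by (metis finite_imp_not_open)
qed

section \<open>The trace of a holomorphic differential vanishes\<close>

lemma zero_section: "0 \<in> H0 A n"
  using sections.subspace_0[OF sections_subspace_H0] .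

text \<open>
The meromorphic function \<open>s / dF\<close>; it is meaningful at regular points only, and it is independent
of the chart since numerator and denominator are multiplied by the same derivative.
\<close>

definition ratio :: "'a diff_section \<Rightarrow> 'a \<Rightarrow> complex" where
  "ratio s p = s (chart_at A p) (snd (chart_at A p) p) / dphi (chart_at A p) p"

lemma ratio_chart:
  assumes s: "s \<in> H0 A 1" and c: "c \<in> A" and p: "p \<in> fst c" "F p \<noteq> None"
  shows "ratio s p = s c (snd c p) / dphi c p"
proof -
  have pX: "p \<in> topspace X" using chart_subset[OF c p(1)] .
  note d = chart_at_in[OF pX] chart_at_mem[OF pX]
  show ?thesis
    using dphi_change_chart[OF c d(1) p(1) d(2) p(2)]
      section_change_chart[OF s c d(1) p(1) d(2)]
      deriv_transition_nonzero[OF c d(1) p(1) d(2)]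
    by (simp add: ratio_def)
qed

lemma eventually_off_fibre:
  assumes c: "c \<in> A" and p: "p \<in> fst c"
  shows "\<forall>\<^sub>F z in at (snd c p). z \<in> snd c ` fst c \<and> F (chart_inv c z) \<noteq> q"
proof -
  define K where "K = snd c ` {x \<in> topspace X. F x = q}"
  have fin: "finite (K - {snd c p})" using finite_fibre by (simp add: K_def)
  have "\<forall>\<^sub>F z in at (snd c p). z \<in> snd c ` fst c - (K - {snd c p}) - {snd c p}"
    using open_chart_range[OF c] p
    by (intro eventually_at_in_open open_Diff finite_imp_closed[OF fin]) auto
  then show ?thesis
  proof eventually_elim
    case (elim z)
    then have z: "z \<in> snd c ` fst c" "z \<notin> K" by auto
    have "chart_inv c z \<in> topspace X" using chart_subset[OF c] chart_inv_in[OF z(1)] .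
    then show ?case using z chart_inv_right[OF z(1)] by (auto simp: K_def image_iff)
  qed
qed

text \<open>
At a point over a finite value \<open>b\<close>, possibly a ramification point, \<open>(F - b) s / dF\<close> is the product of
the holomorphic function \<open>s\<close> and the quotient \<open>(F - b) / (F - b)'\<close>, which tends to zero.
\<close>

lemma chart_limit_finite:
  assumes s: "s \<in> H0 A 1" and c: "c \<in> A" and p: "p \<in> fst c" and b: "F p = Some b"
  shows "\<forall>\<^sub>F z in at (snd c p). regular (chart_inv c z)"
    and "((\<lambda>z. (phi (chart_inv c z) - b) * ratio s (chart_inv c z)) \<longlongrightarrow> 0) (at (snd c p))"
proof -
  define S where "S = snd c ` {x \<in> fst c. F x \<noteq> None}"
  have "open S" "snd c p \<in> S" using open_finite_part[OF c] p b by (auto simp: S_def)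
  then obtain r where r: "r > 0" "ball (snd c p) r \<subseteq> S" using openE by blast
  let ?U = "ball (snd c p) r"
  define f where "f = (\<lambda>z. (phi \<circ> chart_inv c) z - b)"
  have hol: "f holomorphic_on ?U" unfolding f_def
    by (intro holomorphic_intros holomorphic_on_subset[OF phi_holomorphic[OF c]] r(2)[unfolded S_def])
  have inU: "\<forall>\<^sub>F z in at (snd c p). z \<in> ?U - {snd c p}"
    using r(1) by (intro eventually_at_in_open) auto
  have Sd: "chart_inv c z \<in> fst c \<and> F (chart_inv c z) \<noteq> None \<and> snd c (chart_inv c z) = z"
    if "z \<in> S" for z
    using that by (auto simp: S_def chart_inv_left[OF c])
  have "\<forall>\<^sub>F z in at (snd c p). z \<in> ?U \<and> f z \<noteq> 0"
    using inU eventually_off_fibre[OF c p, of "Some b"]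
  proof eventually_elim
    case (elim z)
    then have "F (chart_inv c z) \<noteq> None" using r(2) Sd by blast
    then show ?case using elim by (auto simp: f_def phi_def)
  qed
  then obtain w where w: "w \<in> ?U" "f w \<noteq> 0"
    using eventually_happens[of _ "at (snd c p)"] at_neq_bot by blast
  have f0: "f (snd c p) = 0" by (simp add: f_def phi_def chart_inv_left[OF c p] b)
  note lim = holomorphic_log_derivative_limit[OF hol open_ball connected_ball _ f0 w]
  have df: "deriv f z = dphi c (chart_inv c z)" if "z \<in> ?U" for z
  proof -
    have z: "chart_inv c z \<in> fst c" "F (chart_inv c z) \<noteq> None" "snd c (chart_inv c z) = z"
      using that r(2) Sd by blast+
    have "((phi \<circ> chart_inv c) has_field_derivative dphi c (chart_inv c z)) (at z)"
      using phi_derivative[OF c z(1,2)] z(3) by simp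
    then have "(f has_field_derivative dphi c (chart_inv c z) - 0) (at z)"
      unfolding f_def by (intro DERIV_diff DERIV_const)
    then show ?thesis by (simp add: DERIV_imp_deriv)
  qed
  have "\<forall>\<^sub>F z in at (snd c p). deriv f z \<noteq> 0" using lim(1) r(1) by simp
  then show "\<forall>\<^sub>F z in at (snd c p). regular (chart_inv c z)"
    using inU
  proof eventually_elim
    case (elim z)
    then have "z \<in> S" using r(2) by blast
    with elim show ?case using regular_iff[OF c, of "chart_inv c z"] Sd[of z] df[of z] by simp
  qed
  have "isCont (s c) (snd c p)"
    using holomorphic_on_imp_continuous_on[OF section_holomorphic[OF s c]] open_chart_range[OF c] p
    by (simp add: continuous_on_eq_continuous_at)
  then have "((\<lambda>z. (f z / deriv f z) * s c z) \<longlongrightarrow> 0 * s c (snd c p)) (at (snd c p))"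
    using lim(2) r(1) by (intro tendsto_mult) (simp_all add: isCont_def)
  moreover have "\<forall>\<^sub>F z in at (snd c p). (f z / deriv f z) * s c z
      = (phi (chart_inv c z) - b) * ratio s (chart_inv c z)"
    using inU
  proof eventually_elim
    case (elim z)
    then have "z \<in> S" using r(2) by blast
    with elim show ?case using ratio_chart[OF s c, of "chart_inv c z"] Sd[of z] df[of z]
      by (simp add: f_def)
  qed
  ultimately show "((\<lambda>z. (phi (chart_inv c z) - b) * ratio s (chart_inv c z)) \<longlongrightarrow> 0) (at (snd c p))"
    by (simp add: Lim_transform_eventually)
qed

text \<open>
At a point over infinity the coordinate is \<open>u = 1/F\<close>, and \<open>s / dF = - (u / u') u s\<close>, again with
\<open>u / u'\<close> tending to zero.
\<close>

lemma chart_limit_infinite: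
  assumes s: "s \<in> H0 A 1" and c: "c \<in> A" and p: "p \<in> fst c" and b: "F p = None"
  shows "\<forall>\<^sub>F z in at (snd c p). regular (chart_inv c z)"
    and "((\<lambda>z. ratio s (chart_inv c z)) \<longlongrightarrow> 0) (at (snd c p))"
proof -
  define S where "S = snd c ` {x \<in> fst c. F x \<noteq> Some 0}"
  have "open S" "snd c p \<in> S" using open_off_fibre[OF c] p b by (auto simp: S_def)
  then obtain r where r: "r > 0" "ball (snd c p) r \<subseteq> S" using openE by blast
  let ?U = "ball (snd c p) r"
  define u where "u = psi \<circ> chart_inv c"
  have hol: "u holomorphic_on ?U" unfolding u_def
    by (intro holomorphic_on_subset[OF psi_holomorphic[OF c]] r(2)[unfolded S_def])
  have inU: "\<forall>\<^sub>F z in at (snd c p). z \<in> ?U - {snd c p}"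
    using r(1) by (intro eventually_at_in_open) auto
  have Sd: "chart_inv c z \<in> fst c \<and> F (chart_inv c z) \<noteq> Some 0 \<and> snd c (chart_inv c z) = z"
    if "z \<in> S" for z
    using that by (auto simp: S_def chart_inv_left[OF c])
  have nz: "u z \<noteq> 0" if "F (chart_inv c z) \<noteq> None" "z \<in> S" for z
    using that Sd by (auto simp: u_def psi_def split: option.splits)
  have fin: "\<forall>\<^sub>F z in at (snd c p). z \<in> ?U \<and> F (chart_inv c z) \<noteq> None"
    using inU eventually_off_fibre[OF c p, of None] by eventually_elim auto
  then obtain w where w: "w \<in> ?U" "F (chart_inv c w) \<noteq> None"
    using eventually_happens[of _ "at (snd c p)"] at_neq_bot by blast
  have uw: "u w \<noteq> 0" using nz w r(2) by blast
  have u0: "u (snd c p) = 0" by (simp add: u_def psi_def chart_inv_left[OF c p] b)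
  note lim = holomorphic_log_derivative_limit[OF hol open_ball connected_ball _ u0 w(1) uw]
  have du: "dphi c (chart_inv c z) = - deriv u z / u z ^ 2"
    if "z \<in> ?U" "F (chart_inv c z) \<noteq> None" for z
  proof -
    have zS: "z \<in> S" using that r(2) by blast
    have "(u has_field_derivative deriv u z) (at z)"
      using hol that(1) by (metis holomorphic_derivI open_ball)
    then have "((\<lambda>x. 1 / u x) has_field_derivative - deriv u z / u z ^ 2) (at z)"
      using nz[OF that(2) zS] by (auto intro!: derivative_eq_intros simp: power2_eq_square)
    then have "((phi \<circ> chart_inv c) has_field_derivative - deriv u z / u z ^ 2) (at z)"
    proof (rule has_field_derivative_transform_within_open[OF _ open_finite_part[OF c]])
      show "z \<in> snd c ` {p \<in> fst c. F p \<noteq> None}"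
        using that(2) Sd[OF zS] by (metis (mono_tags, lifting) image_eqI mem_Collect_eq)
      fix x assume "x \<in> snd c ` {p \<in> fst c. F p \<noteq> None}"
      then show "1 / u x = (phi \<circ> chart_inv c) x"
        by (auto simp: u_def psi_def phi_def chart_inv_left[OF c])
    qed
    then have "deriv (phi \<circ> chart_inv c) z = - deriv u z / u z ^ 2" by (rule DERIV_imp_deriv)
    then show ?thesis using Sd[OF zS] by (simp add: dphi_def)
  qed
  have "\<forall>\<^sub>F z in at (snd c p). deriv u z \<noteq> 0" using lim(1) r(1) by simp
  then show "\<forall>\<^sub>F z in at (snd c p). regular (chart_inv c z)"
    using fin
  proof eventually_elim
    case (elim z)
    then have "z \<in> S" using r(2) by blast
    with elim show ?case
      using regular_iff[OF c, of "chart_inv c z"] Sd[of z] du[of z] nz[of z] by simp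
  qed
  have "isCont (s c) (snd c p)"
    using holomorphic_on_imp_continuous_on[OF section_holomorphic[OF s c]] open_chart_range[OF c] p
    by (simp add: continuous_on_eq_continuous_at)
  moreover have "isCont u (snd c p)"
    using holomorphic_on_imp_continuous_on[OF hol] r(1)
    by (simp add: continuous_on_eq_continuous_at)
  ultimately have "((\<lambda>z. - (u z / deriv u z) * u z * s c z) \<longlongrightarrow> - 0 * u (snd c p) * s c (snd c p))
      (at (snd c p))"
    using lim(2) r(1) by (intro tendsto_mult tendsto_minus) (simp_all add: isCont_def)
  moreover have "\<forall>\<^sub>F z in at (snd c p). - (u z / deriv u z) * u z * s c z = ratio s (chart_inv c z)"
    using fin
  proof eventually_elim
    case (elim z)
    then have "z \<in> S" using r(2) by blast
    with elim show ?case
      using ratio_chart[OF s c, of "chart_inv c z"] Sd[of z] du[of z] nz[of z]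
      by (simp add: power2_eq_square)
  qed
  ultimately show "((\<lambda>z. ratio s (chart_inv c z)) \<longlongrightarrow> 0) (at (snd c p))"
    by (simp add: Lim_transform_eventually)
qed

lemma neighbourhood_finite:
  assumes s: "s \<in> H0 A 1" and p: "p \<in> topspace X" "F p = Some b" and e: "e > 0"
  obtains N where "openin X N" "p \<in> N"
    "\<And>x. x \<in> N - {p} \<Longrightarrow> regular x \<and> norm ((phi x - b) * ratio s x) < e"
proof -
  note c = chart_at_in[OF p(1)] chart_at_mem[OF p(1)]
  note lim = chart_limit_finite[OF s c p(2)]
  have "\<forall>\<^sub>F z in at (snd (chart_at A p) p).
      dist ((phi (chart_inv (chart_at A p) z) - b) * ratio s (chart_inv (chart_at A p) z)) 0 < e"
    using tendstoD[OF lim(2) e] .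
  with lim(1) have "\<forall>\<^sub>F z in at (snd (chart_at A p) p). regular (chart_inv (chart_at A p) z) \<and>
      norm ((phi (chart_inv (chart_at A p) z) - b) * ratio s (chart_inv (chart_at A p) z)) < e"
    by eventually_elim simp
  from eventually_at_chart[OF c this] show ?thesis using that by metis
qed

lemma neighbourhood_infinite:
  assumes s: "s \<in> H0 A 1" and p: "p \<in> topspace X" "F p = None" and e: "e > 0"
  obtains N where "openin X N" "p \<in> N" "\<And>x. x \<in> N - {p} \<Longrightarrow> regular x \<and> norm (ratio s x) < e"
proof -
  note c = chart_at_in[OF p(1)] chart_at_mem[OF p(1)]
  note lim = chart_limit_infinite[OF s c p(2)]
  have "\<forall>\<^sub>F z in at (snd (chart_at A p) p). dist (ratio s (chart_inv (chart_at A p) z)) 0 < e"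
    using tendstoD[OF lim(2) e] .
  with lim(1) have "\<forall>\<^sub>F z in at (snd (chart_at A p) p). regular (chart_inv (chart_at A p) z) \<and>
      norm (ratio s (chart_inv (chart_at A p) z)) < e"
    by eventually_elim simp
  from eventually_at_chart[OF c this] show ?thesis using that by metis
qed

text \<open>
By the previous lemmas, every point has a neighbourhood in which all other points are regular, and
finitely many of these neighbourhoods cover the surface.  Regularity does not refer to a
differential, so the zero section can be used.
\<close>

lemma finite_irregular: "finite {p \<in> topspace X. \<not> regular p}"
proof -
  have "\<exists>N. openin X N \<and> p \<in> N \<and> (\<forall>x\<in>N - {p}. regular x)" if p: "p \<in> topspace X" for p
  proof (cases "F p")
    case None
    show ?thesis by (rule neighbourhood_infinite[OF zero_section p None zero_less_one]) blast
  next
    case (Some b)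
    show ?thesis by (rule neighbourhood_finite[OF zero_section p Some zero_less_one]) blast
  qed
  then obtain N where N: "\<And>p. p \<in> topspace X \<Longrightarrow>
      openin X (N p) \<and> p \<in> N p \<and> (\<forall>x\<in>N p - {p}. regular x)"
    by metis
  have "\<exists>\<F>. finite \<F> \<and> \<F> \<subseteq> N ` topspace X \<and> topspace X \<subseteq> \<Union>\<F>"
  proof -
    have "\<forall>U\<in>N ` topspace X. openin X U" "topspace X \<subseteq> \<Union>(N ` topspace X)" using N by auto
    then show ?thesis using compact unfolding compact_space_alt by blast
  qed
  then obtain P where P: "finite P" "P \<subseteq> topspace X" "topspace X \<subseteq> \<Union>(N ` P)"
    by (metis finite_subset_image)
  have "{p \<in> topspace X. \<not> regular p} \<subseteq> P"
  proof
    fix p assume p: "p \<in> {p \<in> topspace X. \<not> regular p}"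
    then obtain x where "x \<in> P" "p \<in> N x" using P(3) by auto
    then show "p \<in> P" using N P(2) p by (metis (mono_tags, lifting) DiffI mem_Collect_eq
          singletonD subsetD)
  qed
  then show ?thesis using P(1) finite_subset by blast
qed

definition branch_values :: "complex set" where
  "branch_values = {b. \<exists>p\<in>fibre b. \<not> regular p}"

lemma finite_branch_values: "finite branch_values"
proof (rule finite_subset)
  show "branch_values \<subseteq> phi ` {p \<in> topspace X. \<not> regular p}"
    by (force simp: branch_values_def fibre_def phi_def)
  show "finite (phi ` {p \<in> topspace X. \<not> regular p})" using finite_irregular by simp
qed

lemma regular_fibre: "b \<notin> branch_values \<Longrightarrow> p \<in> fibre b \<Longrightarrow> regular p"
  by (auto simp: branch_values_def)

lemma card_fibre: "b \<notin> branch_values \<Longrightarrow> card (fibre b) = 2"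
  by (intro card_regular_fibre regular_fibre)

definition trace :: "'a diff_section \<Rightarrow> complex \<Rightarrow> complex" where
  "trace s w = (\<Sum>p\<in>fibre w. ratio s p)"

text \<open>
The local section \<open>\<sigma>\<close> of the covering is the inverse of its expression in a chart, followed by the
inverse of the chart.
\<close>

lemma local_inverse:
  assumes s: "s \<in> H0 A 1" and p: "regular p" "F p = Some b" and U: "openin X U" "p \<in> U"
  obtains W \<sigma> where "open W" "b \<in> W" "\<And>w. w \<in> W \<Longrightarrow> \<sigma> w \<in> U \<inter> fibre w"
    "(\<lambda>w. ratio s (\<sigma> w)) holomorphic_on W"
proof -
  have pX: "p \<in> topspace X" using p by (simp add: regular_def)
  define c where "c = chart_at A p"
  have c: "c \<in> A" "p \<in> fst c" using chart_at_in[OF pX] chart_at_mem[OF pX] by (auto simp: c_def)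
  define S where "S = snd c ` (fst c \<inter> (U \<inter> {x \<in> topspace X. F x \<noteq> None}))"
  define f where "f = phi \<circ> chart_inv c"
  have S: "open S" "snd c p \<in> S"
    unfolding S_def
    by (intro open_chart_of_openin[OF c(1)] openin_Int U openin_finite_part)
      (use c(2) U(2) pX p(2) in auto)
  have Sd: "chart_inv c z \<in> fst c \<inter> U \<and> F (chart_inv c z) \<noteq> None \<and> snd c (chart_inv c z) = z"
    if "z \<in> S" for z
    using that by (auto simp: S_def chart_inv_left[OF c(1)])
  have f: "f holomorphic_on S"
    unfolding f_def S_def by (rule holomorphic_on_subset[OF phi_holomorphic[OF c(1)]]) auto
  have "deriv f (snd c p) \<noteq> 0"
    using regular_iff[OF c] p(1) by (simp add: dphi_def f_def)
  then obtain W g where W: "open W" "f (snd c p) \<in> W" "g holomorphic_on W"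
    and g: "\<And>w. w \<in> W \<Longrightarrow> g w \<in> S \<and> f (g w) = w \<and> deriv f (g w) \<noteq> 0"
    using holomorphic_local_inverse[OF f S] by metis
  show ?thesis
  proof (rule that[OF W(1)])
    show "b \<in> W" using W(2) by (simp add: f_def phi_def chart_inv_left[OF c] p(2))
    show "chart_inv c (g w) \<in> U \<inter> fibre w" if w: "w \<in> W" for w
    proof -
      have "phi (chart_inv c (g w)) = w" using g[OF w] by (simp add: f_def)
      then show ?thesis using Sd[of "g w"] g[OF w] chart_subset[OF c(1)]
        by (auto simp: fibre_def phi_def)
    qed
    have sg: "g ` W \<subseteq> S" using g by auto
    have "S \<subseteq> snd c ` fst c" by (auto simp: S_def)
    then have "(s c \<circ> g) holomorphic_on W"
      using section_holomorphic[OF s c(1)] sg W(3)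
      by (intro holomorphic_on_compose holomorphic_on_subset[where t = "g ` W"]) auto
    moreover have "(deriv f \<circ> g) holomorphic_on W"
      using holomorphic_deriv[OF f S(1)] sg W(3)
      by (intro holomorphic_on_compose holomorphic_on_subset[where t = "g ` W"]) auto
    ultimately have "(\<lambda>w. s c (g w) / deriv f (g w)) holomorphic_on W"
      using g unfolding comp_def by (intro holomorphic_on_divide) auto
    then show "(\<lambda>w. ratio s (chart_inv c (g w))) holomorphic_on W"
    proof (rule holomorphic_transform)
      fix w assume w: "w \<in> W"
      then show "s c (g w) / deriv f (g w) = ratio s (chart_inv c (g w))"
        using g[OF w] Sd[of "g w"] ratio_chart[OF s c(1), of "chart_inv c (g w)"]
        by (simp add: dphi_def f_def)
    qed
  qed
qed

text \<open>
Over an unramified value \<open>b\<close>, the local sections through the two points of the fibre run in disjoint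
open sets; since all the fibres nearby have exactly two points, these are given by the two sections.
\<close>

lemma trace_holomorphic:
  assumes s: "s \<in> H0 A 1"
  shows "trace s holomorphic_on - branch_values"
proof -
  have op: "open (- branch_values)" using finite_branch_values by (simp add: finite_imp_closed open_Compl)
  have "trace s analytic_on {b}" if b: "b \<notin> branch_values" for b
  proof -
    obtain p q where pq: "fibre b = {p, q}" "p \<noteq> q"
      using card_fibre[OF b] by (auto simp: card_2_iff)
    have r: "regular p" "regular q" "p \<in> topspace X" "q \<in> topspace X" "F p = Some b" "F q = Some b"
      using regular_fibre[OF b] pq by (auto simp: fibre_def)
    obtain U V where UV: "openin X U" "openin X V" "p \<in> U" "q \<in> V" "disjnt U V"
      using Hausdorff r pq(2) unfolding Hausdorff_space_def by metis
    obtain W1 \<sigma>1 where 1: "open W1" "b \<in> W1" "\<And>w. w \<in> W1 \<Longrightarrow> \<sigma>1 w \<in> U \<inter> fibre w"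
      "(\<lambda>w. ratio s (\<sigma>1 w)) holomorphic_on W1"
      using local_inverse[OF s r(1,5) UV(1,3)] by blast
    obtain W2 \<sigma>2 where 2: "open W2" "b \<in> W2" "\<And>w. w \<in> W2 \<Longrightarrow> \<sigma>2 w \<in> V \<inter> fibre w"
      "(\<lambda>w. ratio s (\<sigma>2 w)) holomorphic_on W2"
      using local_inverse[OF s r(2,6) UV(2,4)] by blast
    define W where "W = W1 \<inter> W2 \<inter> - branch_values"
    have W: "open W" "b \<in> W" using 1 2 op b by (auto simp: W_def)
    have "(\<lambda>w. ratio s (\<sigma>1 w) + ratio s (\<sigma>2 w)) holomorphic_on W"
      by (intro holomorphic_on_add holomorphic_on_subset[OF 1(4)] holomorphic_on_subset[OF 2(4)])
        (auto simp: W_def)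
    then have "trace s holomorphic_on W"
    proof (rule holomorphic_transform)
      fix w assume w: "w \<in> W"
      then have "w \<in> W1" "w \<in> W2" "w \<notin> branch_values" by (auto simp: W_def)
      note m = 1(3)[OF this(1)] 2(3)[OF this(2)] card_fibre[OF this(3)]
      then have ne: "\<sigma>1 w \<noteq> \<sigma>2 w" using UV(5) by (auto simp: disjnt_iff)
      have "{\<sigma>1 w, \<sigma>2 w} = fibre w"
        using m ne by (intro card_subset_eq finite_fibre_Some) auto
      then have "trace s w = (\<Sum>p\<in>{\<sigma>1 w, \<sigma>2 w}. ratio s p)" by (simp add: trace_def)
      then show "ratio s (\<sigma>1 w) + ratio s (\<sigma>2 w) = trace s w" using ne by simp
    qed
    with W show ?thesis by (auto simp: analytic_at)
  qed
  then have "trace s analytic_on - branch_values"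
    using analytic_on_analytic_at by blast
  then show ?thesis by (rule analytic_imp_holomorphic)
qed

lemma open_P1_finite_part: "openin P1_top V \<Longrightarrow> open {w. Some w \<in> V}"
  using openin_continuous_map_preimage[OF continuous_map_Some, of euclidean V]
  by (simp add: P1_top_def)

lemma eventually_P1_infinity:
  assumes V: "openin P1_top V" "None \<in> V"
  shows "\<forall>\<^sub>F w in at_infinity. Some w \<in> V"
proof -
  obtain C where C: "compactin euclidean C" "V = insert None (Some ` (UNIV - C))"
    using V unfolding P1_top_def openin_Alexandroff_compactification by auto
  have "bounded C" using C(1) by (simp add: compact_imp_bounded)
  from eventually_at_infinity_notin[OF this] show ?thesis
    by eventually_elim (simp add: C(2))
qed

text \<open>
The fibre of a value close to \<open>b\<close> lies in a small neighbourhood of the fibre of \<open>b\<close>, where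
\<open>(F - b) s / dF\<close> is small, and it has only two points.
\<close>

lemma trace_limit_finite:
  assumes s: "s \<in> H0 A 1"
  shows "((\<lambda>w. (w - b) * trace s w) \<longlongrightarrow> 0) (at b)"
proof (rule tendstoI)
  fix e :: real assume e: "e > 0"
  have "\<exists>N. openin X N \<and> p \<in> N \<and> (\<forall>x\<in>N - {p}. norm ((phi x - b) * ratio s x) < e / 3)"
    if "p \<in> fibre b" for p
  proof -
    have p: "p \<in> topspace X" "F p = Some b" using that by (auto simp: fibre_def)
    have "e / 3 > 0" using e by simp
    from neighbourhood_finite[OF s p this] show ?thesis by metis
  qed
  then obtain N where N: "\<And>p. p \<in> fibre b \<Longrightarrow>
      openin X (N p) \<and> p \<in> N p \<and> (\<forall>x\<in>N p - {p}. norm ((phi x - b) * ratio s x) < e / 3)"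
    by metis
  have op: "openin X (\<Union>(N ` fibre b))" using N by (intro openin_Union) auto
  have cover: "p \<in> \<Union>(N ` fibre b)" if "p \<in> topspace X" "F p = Some b" for p
    using N[of p] that by (auto simp: fibre_def)
  have "\<exists>V. openin P1_top V \<and> Some b \<in> V \<and> (\<forall>p\<in>topspace X. F p \<in> V \<longrightarrow> p \<in> \<Union>(N ` fibre b))"
    by (rule fibre_neighbourhood[OF op]) (rule cover)
  then obtain V where V: "openin P1_top V" "Some b \<in> V"
    "\<forall>p\<in>topspace X. F p \<in> V \<longrightarrow> p \<in> \<Union>(N ` fibre b)"
    by (elim exE conjE) (rule that)
  have "finite (branch_values - {b})" using finite_branch_values by simp
  then have "open ({w. Some w \<in> V} - (branch_values - {b}))"
    using open_P1_finite_part[OF V(1)] by (intro open_Diff finite_imp_closed)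
  then have "\<forall>\<^sub>F w in at b. w \<in> {w. Some w \<in> V} - (branch_values - {b}) - {b}"
    using V(2) by (intro eventually_at_in_open) auto
  then show "\<forall>\<^sub>F w in at b. dist ((w - b) * trace s w) 0 < e"
  proof eventually_elim
    case (elim w)
    have "norm ((w - b) * ratio s p) \<le> e / 3" if p: "p \<in> fibre w" for p
    proof -
      have "p \<in> topspace X" "F p = Some w" using p by (auto simp: fibre_def)
      then have "p \<in> \<Union>(N ` fibre b)" using bspec[OF V(3), of p] elim by simp
      then obtain x where x: "x \<in> fibre b" "p \<in> N x" by (rule UN_E)
      then have "p \<noteq> x" using p elim by (auto simp: fibre_def)
      then have "norm ((phi p - b) * ratio s p) < e / 3" using N[OF x(1)] x(2) by blast
      then show ?thesis using \<open>F p = Some w\<close> by (simp add: phi_def)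
    qed
    then have "norm ((w - b) * trace s w) \<le> of_nat (card (fibre w)) * (e / 3)"
      unfolding trace_def sum_distrib_left by (rule sum_norm_bound)
    also have "card (fibre w) = 2" using card_fibre elim by auto
    finally show ?case using e by simp
  qed
qed

lemma trace_limit_infinite:
  assumes s: "s \<in> H0 A 1"
  shows "(trace s \<longlongrightarrow> 0) at_infinity"
proof (rule tendstoI)
  fix e :: real assume e: "e > 0"
  let ?P = "{p \<in> topspace X. F p = None}"
  have "\<exists>N. openin X N \<and> p \<in> N \<and> (\<forall>x\<in>N - {p}. norm (ratio s x) < e / 3)" if "p \<in> ?P" for p
  proof -
    have p: "p \<in> topspace X" "F p = None" using that by auto
    have "e / 3 > 0" using e by simp
    from neighbourhood_infinite[OF s p this] show ?thesis by metis
  qed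
  then obtain N where N: "\<And>p. p \<in> ?P \<Longrightarrow>
      openin X (N p) \<and> p \<in> N p \<and> (\<forall>x\<in>N p - {p}. norm (ratio s x) < e / 3)"
    by metis
  have op: "openin X (\<Union>(N ` ?P))" using N by (intro openin_Union) auto
  have cover: "p \<in> \<Union>(N ` ?P)" if "p \<in> topspace X" "F p = None" for p
    using N[of p] that by auto
  have "\<exists>V. openin P1_top V \<and> None \<in> V \<and> (\<forall>p\<in>topspace X. F p \<in> V \<longrightarrow> p \<in> \<Union>(N ` ?P))"
    by (rule fibre_neighbourhood[OF op]) (rule cover)
  then obtain V where V: "openin P1_top V" "None \<in> V"
    "\<forall>p\<in>topspace X. F p \<in> V \<longrightarrow> p \<in> \<Union>(N ` ?P)"
    by (elim exE conjE) (rule that)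
  have "\<forall>\<^sub>F w in at_infinity. w \<notin> branch_values"
    by (intro eventually_at_infinity_notin finite_imp_bounded finite_branch_values)
  then show "\<forall>\<^sub>F w in at_infinity. dist (trace s w) 0 < e"
    using eventually_P1_infinity[OF V(1,2)]
  proof eventually_elim
    case (elim w)
    have "norm (ratio s p) \<le> e / 3" if p: "p \<in> fibre w" for p
    proof -
      have p': "p \<in> topspace X" "F p = Some w" using p by (auto simp: fibre_def)
      then have "p \<in> \<Union>(N ` ?P)" using bspec[OF V(3), of p] elim by simp
      then obtain x where x: "x \<in> ?P" "p \<in> N x" by (rule UN_E)
      then have "p \<noteq> x" using p' by auto
      then have "norm (ratio s p) < e / 3" using N[OF x(1)] x(2) by blast
      then show ?thesis by simp
    qed
    then have "norm (trace s w) \<le> of_nat (card (fibre w)) * (e / 3)"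
      unfolding trace_def by (rule sum_norm_bound)
    also have "\<dots> < e" using card_fibre[of w] elim e by simp
    finally show ?case by simp
  qed
qed

lemma trace_zero:
  assumes "s \<in> H0 A 1" "w \<notin> branch_values"
  shows "trace s w = 0"
  using holomorphic_off_finite_eq_zero[OF finite_branch_values trace_holomorphic[OF assms(1)]]
    trace_limit_finite[OF assms(1)] trace_limit_infinite[OF assms(1)] assms(2)
  by blast

end

section \<open>Multiplying differentials by a function with one polar fibre\<close>

text \<open>
If each step \<open>W (m + 1)\<close> of a chain has codimension at most one in \<open>W m\<close>, then \<open>W m\<close> has codimension
at most \<open>m\<close> in \<open>W 0\<close>.  Codimension is expressed through a finite set \<open>E\<close>, so that no quotient space has
to be formed.
\<close>

lemma (in vector_space) subtract_step:
  assumes "\<And>m x y. x \<in> W m \<Longrightarrow> y \<in> W m \<Longrightarrow> x \<notin> W (Suc m) \<Longrightarrow> \<exists>a. y - scale a x \<in> W (Suc m)"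
  shows "\<exists>E. finite E \<and> card E \<le> m \<and> (\<forall>y\<in>W 0. \<exists>e\<in>span E. y - e \<in> W m)"
proof (induction m)
  case 0
  show ?case by (rule exI[of _ "{}"]) simp
next
  case (Suc m)
  then obtain E where E: "finite E" "card E \<le> m" "\<And>y. y \<in> W 0 \<Longrightarrow> \<exists>e\<in>span E. y - e \<in> W m"
    by blast
  show ?case
  proof (cases "W m \<subseteq> W (Suc m)")
    case True
    with E show ?thesis by (intro exI[of _ E]) (meson le_Suc_eq subsetD)
  next
    case False
    then obtain x where x: "x \<in> W m" "x \<notin> W (Suc m)" by blast
    have "\<exists>e\<in>span (insert x E). y - e \<in> W (Suc m)" if y: "y \<in> W 0" for y
    proof -
      obtain e where e: "e \<in> span E" "y - e \<in> W m" using E(3)[OF y] by blast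
      obtain a where a: "y - e - scale a x \<in> W (Suc m)" using assms[OF x(1) e(2) x(2)] by blast
      have "e \<in> span (insert x E)" using e(1) span_mono[of E "insert x E"] by blast
      moreover have "scale a x \<in> span (insert x E)" by (intro span_scale span_base) simp
      ultimately have "e + scale a x \<in> span (insert x E)" by (rule span_add)
      moreover have "y - (e + scale a x) \<in> W (Suc m)" using a by (simp add: diff_diff_eq)
      ultimately show ?thesis by blast
    qed
    moreover have "card (insert x E) \<le> Suc m" using E(1,2) by (simp add: card_insert_if)
    ultimately show ?thesis using E(1) by (intro exI[of _ "insert x E"]) simp
  qed
qed

context double_cover
begin

text \<open>
The function \<open>T = 1/(F - q)\<close>, which is zero at the points over infinity.  At the points over \<open>q\<close>, its
poles, the value \<open>1 / 0 = 0\<close> is a dummy.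
\<close>

definition pole :: "complex \<Rightarrow> 'a \<Rightarrow> complex" where
  "pole q p = (case F p of None \<Rightarrow> 0 | Some w \<Rightarrow> 1 / (w - q))"

text \<open>
Over infinity, \<open>T = u / (1 - q u)\<close> in the coordinate \<open>u = 1/F\<close>, with a denominator that is zero over
\<open>q\<close> only.
\<close>

lemma pole_holomorphic:
  assumes c: "c \<in> A"
  shows "(pole q \<circ> chart_inv c) holomorphic_on snd c ` {p \<in> fst c. F p \<noteq> Some q}"
proof -
  define O1 where "O1 = snd c ` {p \<in> fst c. F p \<noteq> None \<and> F p \<noteq> Some q}"
  define O2 where "O2 = snd c ` {p \<in> fst c. F p \<noteq> Some 0 \<and> F p \<noteq> Some q}"
  have int: "{p \<in> topspace X. P p \<and> Q p} = {p \<in> topspace X. P p} \<inter> {p \<in> topspace X. Q p}" for P Q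
    by auto
  have op: "open O1" "open O2"
    unfolding O1_def O2_def
    by (intro open_chart_part[OF c], simp only: int,
        intro openin_Int openin_finite_part openin_off_fibre)+
  have "(\<lambda>z. 1 / ((phi \<circ> chart_inv c) z - q)) holomorphic_on O1"
    by (intro holomorphic_intros holomorphic_on_subset[OF phi_holomorphic[OF c]])
      (auto simp: O1_def phi_def chart_inv_left[OF c])
  then have 1: "(pole q \<circ> chart_inv c) holomorphic_on O1"
    by (rule holomorphic_transform) (auto simp: O1_def phi_def pole_def chart_inv_left[OF c])
  have nz: "q * psi p \<noteq> 1" if "F p \<noteq> Some 0" "F p \<noteq> Some q" for p
    using that by (cases "F p") (auto simp: psi_def divide_simps)
  have "(\<lambda>z. (psi \<circ> chart_inv c) z / (1 - q * (psi \<circ> chart_inv c) z)) holomorphic_on O2"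
    by (intro holomorphic_intros holomorphic_on_subset[OF psi_holomorphic[OF c]])
      (auto simp: O2_def nz chart_inv_left[OF c])
  then have 2: "(pole q \<circ> chart_inv c) holomorphic_on O2"
  proof (rule holomorphic_transform)
    fix z assume "z \<in> O2"
    then obtain p where p: "p \<in> fst c" "F p \<noteq> Some 0" "F p \<noteq> Some q" "z = snd c p"
      by (auto simp: O2_def)
    show "(psi \<circ> chart_inv c) z / (1 - q * (psi \<circ> chart_inv c) z) = (pole q \<circ> chart_inv c) z"
      using p by (cases "F p") (auto simp: psi_def pole_def chart_inv_left[OF c] divide_simps)
  qed
  have "snd c ` {p \<in> fst c. F p \<noteq> Some q} = O1 \<union> O2" by (auto simp: O1_def O2_def)
  then show ?thesis using holomorphic_on_Un[OF 1 2 op] by simp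
qed

lemma fibre_chart_finite: "finite (snd c ` (fst c \<inter> fibre q))"
  using finite_fibre_Some by simp

lemma chart_eq_off_fibre:
  fixes f g :: "complex \<Rightarrow> complex"
  assumes c: "c \<in> A" and U: "openin X U" "U \<subseteq> fst c"
    and f: "continuous_on (snd c ` U) f" and g: "continuous_on (snd c ` U) g"
    and eq: "\<And>p. p \<in> U \<Longrightarrow> F p \<noteq> Some q \<Longrightarrow> f (snd c p) = g (snd c p)" and p: "p \<in> U"
  shows "f (snd c p) = g (snd c p)"
proof (rule continuous_eq_off_finite[OF _ f g fibre_chart_finite[of c q]])
  have "fst c \<inter> U = U" using U(2) by blast
  then show "open (snd c ` U)" using open_chart_of_openin[OF c U(1)] by simp
  show "snd c p \<in> snd c ` U" using p by simp
  fix z assume z: "z \<in> snd c ` U - snd c ` (fst c \<inter> fibre q)"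
  then obtain x where x: "x \<in> U" "z = snd c x" by blast
  then have "x \<notin> fibre q" using z U(2) by blast
  then show "f z = g z" using eq[of x] x U(2) chart_subset[OF c] by (auto simp: fibre_def)
qed

text \<open>
The section \<open>t\<close> is \<open>T\<^bsup>i\<^esup> s\<close>.  The fibre over \<open>q\<close> is left out because the product is undefined there; by
continuity, \<open>t\<close> is determined by \<open>s\<close> all the same.
\<close>

definition times_power :: "complex \<Rightarrow> nat \<Rightarrow> 'a diff_section \<Rightarrow> 'a diff_section \<Rightarrow> bool" where
  "times_power q i s t \<longleftrightarrow> t \<in> H0 A 1 \<and>
     (\<forall>c\<in>A. \<forall>p\<in>fst c. F p \<noteq> Some q \<longrightarrow> t c (snd c p) = pole q p ^ i * s c (snd c p))"

text \<open>
The two values of \<open>s / dF\<close> on an unramified fibre are opposite, because the trace is zero.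
\<close>

lemma vanishes_on_fibre:
  assumes s: "s \<in> H0 A 1" and q: "q \<notin> branch_values" and p: "p \<in> fibre q" "ratio s p = 0"
    and x: "x \<in> fibre q" "c \<in> A" "x \<in> fst c"
  shows "s c (snd c x) = 0" "dphi c x \<noteq> 0"
proof -
  have "card (fibre q) = 2" by (rule card_fibre[OF q])
  then obtain p' where p': "fibre q = {p, p'}" "p \<noteq> p'"
    using p(1) by (metis card_2_iff doubleton_eq_iff insert_iff singletonD)
  have "ratio s p + ratio s p' = trace s q" using p' by (simp add: trace_def)
  then have "ratio s x = 0" using trace_zero[OF s q] p(2) x(1) p'(1) by auto
  moreover have "F x = Some q" using x(1) by (simp add: fibre_def)
  moreover show "dphi c x \<noteq> 0" using regular_fibre[OF q x(1)] regular_iff[OF x(2,3)] by simp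
  ultimately show "s c (snd c x) = 0" using ratio_chart[OF s x(2,3)] by simp
qed

text \<open>
As \<open>F - q\<close> has simple zeros at both points of the unramified fibre, and \<open>s\<close> vanishes there, \<open>s/(F - q)\<close>
has removable singularities.  The transformation rule extends to the fibre by continuity.
\<close>

lemma divide_section:
  assumes s: "s \<in> H0 A 1" and q: "q \<notin> branch_values" and p: "p \<in> fibre q" "ratio s p = 0"
  shows "\<exists>t. times_power q 1 s t"
proof -
  define t where "t = (\<lambda>c z. if c \<in> A \<and> z \<in> snd c ` fst c then
     (if F (chart_inv c z) = Some q then deriv (s c) z / dphi c (chart_inv c z)
      else pole q (chart_inv c z) * s c z) else 0)"
  have off: "t c (snd c x) = pole q x * s c (snd c x)"
    if "c \<in> A" "x \<in> fst c" "F x \<noteq> Some q" for c x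
    using that by (simp add: t_def chart_inv_left)
  have hol: "t c holomorphic_on snd c ` fst c" if c: "c \<in> A" for c
  proof -
    define O1 where "O1 = snd c ` {p \<in> fst c. F p \<noteq> None}"
    define O2 where "O2 = snd c ` {p \<in> fst c. F p \<noteq> Some q}"
    have op: "open O1" "open O2" using open_finite_part[OF c] open_off_fibre[OF c]
      by (auto simp: O1_def O2_def)
    have sub: "O1 \<subseteq> snd c ` fst c" "O2 \<subseteq> snd c ` fst c" by (auto simp: O1_def O2_def)
    have sO: "s c holomorphic_on O1" "s c holomorphic_on O2"
      using section_holomorphic[OF s c] sub by (auto intro: holomorphic_on_subset)
    define f where "f = (\<lambda>z. (phi \<circ> chart_inv c) z - q)"
    have f: "f holomorphic_on O1" unfolding f_def O1_def
      by (intro holomorphic_intros phi_holomorphic[OF c])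
    have df: "deriv f (snd c x) = dphi c x" if x: "x \<in> fst c" "F x \<noteq> None" for x
    proof -
      have "(f has_field_derivative dphi c x - 0) (at (snd c x))"
        unfolding f_def by (intro DERIV_diff DERIV_const phi_derivative[OF c x])
      then show ?thesis by (simp add: DERIV_imp_deriv)
    qed
    have f0: "f (snd c x) = 0 \<longleftrightarrow> F x = Some q" if "x \<in> fst c" "F x \<noteq> None" for x
      using that by (auto simp: f_def phi_def chart_inv_left[OF c])
    have "(\<lambda>z. if f z = 0 then deriv (s c) z / deriv f z else s c z / f z) holomorphic_on O1"
    proof (rule holomorphic_quotient_simple_zero[OF sO(1) f op(1)])
      fix z assume "z \<in> O1" "f z = 0"
      then obtain x where x: "x \<in> fst c" "z = snd c x" "F x = Some q" "F x \<noteq> None"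
        using f0 by (auto simp: O1_def)
      then have "x \<in> fibre q" using chart_subset[OF c] by (simp add: fibre_def)
      from vanishes_on_fibre[OF s q p this c x(1)]
      show "s c z = 0 \<and> deriv f z \<noteq> 0" using df[OF x(1,4)] x(2) by simp
    qed
    then have 1: "t c holomorphic_on O1"
    proof (rule holomorphic_transform)
      fix z assume "z \<in> O1"
      then obtain x w where x: "x \<in> fst c" "z = snd c x" "F x = Some w" by (auto simp: O1_def)
      then show "(if f z = 0 then deriv (s c) z / deriv f z else s c z / f z) = t c z"
        using df[OF x(1)] f0[OF x(1)] c
        by (simp add: t_def chart_inv_left[OF c] pole_def) (simp add: f_def phi_def chart_inv_left[OF c])
    qed
    have "(\<lambda>z. (pole q \<circ> chart_inv c) z * s c z) holomorphic_on O2"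
      using holomorphic_on_mult[OF pole_holomorphic[OF c, of q] sO(2)[unfolded O2_def]]
      unfolding O2_def .
    then have 2: "t c holomorphic_on O2"
    proof (rule holomorphic_transform)
      fix z assume "z \<in> O2"
      then obtain x where x: "x \<in> fst c" "F x \<noteq> Some q" "z = snd c x" by (auto simp: O2_def)
      then show "(pole q \<circ> chart_inv c) z * s c z = t c z"
        using off[OF c x(1,2)] by (simp add: chart_inv_left[OF c])
    qed
    have "snd c ` fst c = O1 \<union> O2" by (auto simp: O1_def O2_def)
    then show ?thesis using holomorphic_on_Un[OF 1 2 op] by simp
  qed
  have trans: "t c (snd c x) = t d (snd d x) * deriv (transition c d) (snd c x) ^ 1"
    if c: "c \<in> A" and d: "d \<in> A" and x: "x \<in> fst c \<inter> fst d" for c d x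
  proof -
    let ?U = "fst c \<inter> fst d"
    let ?D = "snd c ` ?U"
    have D: "open ?D" by (rule open_chart_image[OF atlas c d])
    have T: "transition c d holomorphic_on ?D"
      using atlas c d by (simp add: holomorphic_atlas_def)
    have Td: "transition c d ` ?D \<subseteq> snd d ` fst d"
      by (auto simp: transition_apply[OF c])
    have "t c (snd c x) = (\<lambda>z. (t d \<circ> transition c d) z * deriv (transition c d) z) (snd c x)"
    proof (rule chart_eq_off_fibre[OF c, of ?U])
      show "openin X ?U" using chart_openin c d by blast
      show "continuous_on ?D (t c)"
        using hol[OF c] by (intro holomorphic_on_imp_continuous_on)
          (auto intro: holomorphic_on_subset)
      show "continuous_on ?D (\<lambda>z. (t d \<circ> transition c d) z * deriv (transition c d) z)"
        by (intro holomorphic_on_imp_continuous_on holomorphic_on_mult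
            holomorphic_on_compose_gen[OF T hol[OF d] Td] holomorphic_deriv[OF T D])
      fix y assume y: "y \<in> ?U" "F y \<noteq> Some q"
      then show "t c (snd c y) = (t d \<circ> transition c d) (snd c y) * deriv (transition c d) (snd c y)"
        using off[OF c] off[OF d] section_change_chart[OF s c d] by (simp add: transition_apply[OF c])
    qed (use x in auto)
    then show ?thesis using x by (simp add: transition_apply[OF c])
  qed
  have "t c z = 0" if "c \<notin> A \<or> z \<notin> snd c ` fst c" for c z
    using that by (auto simp: t_def)
  then have "t \<in> H0 A 1"
    unfolding H0_def using hol trans by blast
  then have "times_power q 1 s t" using off by (simp add: times_power_def)
  then show ?thesis by blast
qed

lemma minus_scale_apply:
  "(y - scale_section a x) c z = y c z - a * x c z"
  by (simp add: scale_section_def)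

lemma H0_minus_scale:
  "x \<in> H0 A n \<Longrightarrow> y \<in> H0 A n \<Longrightarrow> y - scale_section a x \<in> H0 A n"
  by (intro sections.subspace_diff sections.subspace_scale sections_subspace_H0)

lemma times_power_minus_scale:
  assumes "times_power q i x tx" "times_power q i y ty"
  shows "times_power q i (y - scale_section a x) (ty - scale_section a tx)"
proof -
  have "tx \<in> H0 A 1" "ty \<in> H0 A 1" using assms by (auto simp: times_power_def)
  then have "ty - scale_section a tx \<in> H0 A 1" by (rule H0_minus_scale)
  then show ?thesis
    using assms unfolding times_power_def by (auto simp: scale_section_def algebra_simps)
qed

text \<open>
The differentials \<open>s\<close> such that \<open>s, T s, \<dots>, T\<^bsup>m\<^esup> s\<close> are all holomorphic.  If \<open>q\<close> is not a
branch value, this means that \<open>s\<close> vanishes to order at least \<open>m\<close> at both points over \<open>q\<close>.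
\<close>

definition multiples :: "complex \<Rightarrow> nat \<Rightarrow> 'a diff_section set" where
  "multiples q m = {s \<in> H0 A 1. \<forall>i\<le>m. \<exists>t. times_power q i s t}"

lemma multiples_0: "multiples q 0 = H0 A 1"
  by (auto simp: multiples_def times_power_def)

text \<open>
The condition on \<open>T\<^bsup>m\<^esup> s\<close> to be divisible once more is the vanishing of its value at one point of the
fibre, which is a single linear condition.
\<close>

lemma multiples_step:
  assumes q: "q \<notin> branch_values" and x: "x \<in> multiples q m" "x \<notin> multiples q (Suc m)"
    and y: "y \<in> multiples q m"
  shows "\<exists>a. y - scale_section a x \<in> multiples q (Suc m)"
proof -
  have Suc: "\<exists>t'. times_power q (Suc m) s t'"
    if t: "times_power q m s t" and p: "p \<in> fibre q" "ratio t p = 0" for s t p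
  proof -
    have "t \<in> H0 A 1" using t by (simp add: times_power_def)
    from divide_section[OF this q p] obtain t' where "times_power q 1 t t'" by blast
    then have "times_power q (Suc m) s t'" using t by (simp add: times_power_def mult_ac)
    then show ?thesis by blast
  qed
  have "fibre q \<noteq> {}" using card_fibre[OF q] by auto
  then obtain p where p: "p \<in> fibre q" by blast
  have "\<exists>t. times_power q m x t" "\<exists>t. times_power q m y t"
    using x(1) y unfolding multiples_def by blast+
  then obtain tx ty where t: "times_power q m x tx" "times_power q m y ty" by blast
  have "ratio tx p \<noteq> 0"
    using Suc[OF t(1) p] x by (auto simp: multiples_def le_Suc_eq)
  \<comment> \<open>This multiple of \<open>x\<close> cancels the value of \<open>T\<^bsup>m\<^esup> y\<close> at \<open>p\<close>.\<close>
  define a where "a = ratio ty p / ratio tx p"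
  have "ratio (ty - scale_section a tx) p = ratio ty p - a * ratio tx p"
    unfolding ratio_def minus_scale_apply by (simp add: diff_divide_distrib)
  then have "ratio (ty - scale_section a tx) p = 0"
    using \<open>ratio tx p \<noteq> 0\<close> by (simp add: a_def)
  from Suc[OF times_power_minus_scale[OF t] p this]
  have "\<exists>t'. times_power q (Suc m) (y - scale_section a x) t'" .
  moreover have "\<exists>t'. times_power q i (y - scale_section a x) t'" if "i \<le> m" for i
    using x(1) y that times_power_minus_scale by (fastforce simp: multiples_def)
  moreover have "y - scale_section a x \<in> H0 A 1"
    using x(1) y by (intro H0_minus_scale) (auto simp: multiples_def)
  ultimately show ?thesis by (auto simp: multiples_def le_Suc_eq)
qed

text \<open>
Otherwise the space of differentials, of dimension \<open>g\<close>, would be spanned by \<open>g - 1\<close> elements.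
\<close>

lemma exists_multiple:
  assumes q: "q \<notin> branch_values" and basis: "canonical_basis A g \<omega>" and g: "g \<ge> 1"
  shows "\<exists>s\<in>multiples q (g - 1). s \<noteq> 0"
proof (rule ccontr)
  assume "\<not> ?thesis"
  then have zero: "s = 0" if "s \<in> multiples q (g - 1)" for s using that by blast
  obtain E where E: "finite E" "card E \<le> g - 1"
    "\<And>y. y \<in> multiples q 0 \<Longrightarrow> \<exists>e\<in>sections.span E. y - e \<in> multiples q (g - 1)"
    using sections.subtract_step[of "multiples q" "g - 1"] multiples_step[OF q] by blast
  have "H0 A 1 \<subseteq> sections.span E"
  proof
    fix y assume "y \<in> H0 A 1"
    then obtain e where "e \<in> sections.span E" "y - e \<in> multiples q (g - 1)"
      using E(3) by (auto simp: multiples_0)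
    then show "y \<in> sections.span E" using zero[of "y - e"] by simp
  qed
  moreover have "\<omega> ` {..<g} \<subseteq> H0 A 1"
    using basis sections.span_superset[of "\<omega> ` {..<g}"] by (simp add: canonical_basis_def)
  ultimately have "\<omega> ` {..<g} \<subseteq> sections.span E" by blast
  moreover have "sections.independent (\<omega> ` {..<g})" using basis by (simp add: canonical_basis_def)
  ultimately have "card (\<omega> ` {..<g}) \<le> card E"
    using sections.independent_span_bound[OF E(1)] by blast
  moreover have "card (\<omega> ` {..<g}) = g"
    using basis by (simp add: canonical_basis_def card_image)
  ultimately show False using E(2) g by simp
qed

end

section \<open>Independence of the chosen basis\<close>

lemma (in vector_space) independent_family:
  assumes I: "finite I"
    and z: "\<And>u i. (\<Sum>i\<in>I. scale (u i) (v i)) = 0 \<Longrightarrow> i \<in> I \<Longrightarrow> u i = 0"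
  shows "inj_on v I" "independent (v ` I)"
proof -
  show inj: "inj_on v I"
  proof (rule inj_onI, rule ccontr)
    fix i j assume ij: "i \<in> I" "j \<in> I" "v i = v j" "i \<noteq> j"
    have single: "(\<Sum>k\<in>I. scale (if k = l then 1 else 0) (v k)) = v l" if "l \<in> I" for l
      by (subst sum.remove[OF I that]) (auto intro!: sum.neutral)
    have "(\<Sum>k\<in>I. scale ((if k = i then 1 else 0) - (if k = j then 1 else 0)) (v k)) = 0"
      unfolding scale_left_diff_distrib sum_subtractf using single ij by simp
    from z[OF this ij(1)] show False using ij(4) by simp
  qed
  show "independent (v ` I)"
  proof (rule independent_if_scalars_zero)
    show "finite (v ` I)" using I by simp
    fix f x assume s: "(\<Sum>x\<in>v ` I. scale (f x) x) = 0" and x: "x \<in> v ` I"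
    have "(\<Sum>i\<in>I. scale ((f \<circ> v) i) (v i)) = 0"
      using s inj by (simp add: sum.reindex)
    from z[OF this] x show "f x = 0" by auto
  qed
qed

lemma (in vector_space) span_eq_of_card:
  assumes T: "finite T" "card T \<le> card S" and S: "independent S" "S \<subseteq> span T"
  shows "span S = span T"
proof
  show "span S \<subseteq> span T" using S(2) by (simp add: span_minimal)
  have fin: "finite S" using independent_span_bound[OF T(1) S] by simp
  have "v \<in> span S" if "v \<in> T" for v
  proof (rule ccontr)
    assume v: "v \<notin> span S"
    then have "independent (insert v S)" using S(1) by (rule independent_insertI)
    moreover have "insert v S \<subseteq> span T" using that S(2) span_base by blast
    ultimately have "card (insert v S) \<le> card T" using independent_span_bound[OF T(1)] by blast
    moreover have "v \<notin> S" using v span_base by blast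
    ultimately show False using fin T(2) by simp
  qed
  then show "span T \<subseteq> span S" by (simp add: span_minimal subsetI)
qed

lemma sum_section_apply:
  "(\<Sum>i\<in>I. scale_section (u i) (v i)) c z = (\<Sum>i\<in>I. u i * v i c z)"
  by (induction I rule: infinite_finite_induct) (simp_all add: scale_section_def zero_fun_def)

lemma bilinear_change_of_basis:
  fixes P :: "nat \<Rightarrow> nat \<Rightarrow> complex"
  shows "(\<Sum>i<g. \<Sum>j<g. a i j * (\<Sum>k<g. P i k * x k) * (\<Sum>l<g. P j l * y l))
    = (\<Sum>k<g. \<Sum>l<g. (\<Sum>i<g. \<Sum>j<g. a i j * P i k * P j l) * x k * y l)"
proof -
  have "(\<Sum>i<g. \<Sum>j<g. a i j * (\<Sum>k<g. P i k * x k) * (\<Sum>l<g. P j l * y l))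
      = (\<Sum>i<g. \<Sum>j<g. \<Sum>k<g. \<Sum>l<g. a i j * P i k * P j l * x k * y l)"
    by (simp add: sum_distrib_left sum_distrib_right mult_ac)
  also have "\<dots> = (\<Sum>i<g. \<Sum>k<g. \<Sum>j<g. \<Sum>l<g. a i j * P i k * P j l * x k * y l)"
    by (intro sum.cong refl sum.swap)
  also have "\<dots> = (\<Sum>k<g. \<Sum>i<g. \<Sum>j<g. \<Sum>l<g. a i j * P i k * P j l * x k * y l)"
    by (rule sum.swap)
  also have "\<dots> = (\<Sum>k<g. \<Sum>i<g. \<Sum>l<g. \<Sum>j<g. a i j * P i k * P j l * x k * y l)"
    by (intro sum.cong refl sum.swap)
  also have "\<dots> = (\<Sum>k<g. \<Sum>l<g. \<Sum>i<g. \<Sum>j<g. a i j * P i k * P j l * x k * y l)"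
    by (intro sum.cong refl sum.swap)
  finally show ?thesis by (simp add: sum_distrib_right)
qed

lemma canonical_basis_section: "canonical_basis A g \<omega> \<Longrightarrow> i < g \<Longrightarrow> \<omega> i \<in> H0 A 1"
  using sections.span_base[of "\<omega> i" "\<omega> ` {..<g}"] by (auto simp: canonical_basis_def)

text \<open>
If \<open>\<omega> = P \<omega>'\<close>, then the tensor with the matrix \<open>a\<close> has the matrix \<open>P\<^sup>t a P\<close> with respect to \<open>\<omega>'\<close>, and
the formula of the second Gaussian map by first derivatives is visibly bilinear.
\<close>

lemma mu2_image_subset:
  assumes atl: "holomorphic_atlas X A"
    and b: "canonical_basis A g \<omega>" and b': "canonical_basis A g \<omega>'"
  shows "mu2 A g \<omega> ` I2 g \<omega> \<subseteq> mu2 A g \<omega>' ` I2 g \<omega>'"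
proof
  fix s assume "s \<in> mu2 A g \<omega> ` I2 g \<omega>"
  then obtain a where a: "a \<in> I2 g \<omega>" and s: "s = mu2 A g \<omega> a" by blast
  have "\<exists>u. \<omega> i = (\<Sum>j<g. scale_section (u j) (\<omega>' j))" if i: "i < g" for i
  proof -
    have "\<omega> i \<in> sections.span (\<omega>' ` {..<g})"
      using canonical_basis_section[OF b i] b' by (simp add: canonical_basis_def)
    then obtain u where "\<omega> i = (\<Sum>x\<in>\<omega>' ` {..<g}. scale_section (u x) x)"
      by (auto simp: sections.span_finite)
    also have "\<dots> = (\<Sum>j<g. scale_section (u (\<omega>' j)) (\<omega>' j))"
      using b' by (simp add: canonical_basis_def sum.reindex)
    finally show ?thesis by (rule exI[of _ "\<lambda>j. u (\<omega>' j)"])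
  qed
  then obtain P where P: "\<And>i. i < g \<Longrightarrow> \<omega> i = (\<Sum>j<g. scale_section (P i j) (\<omega>' j))" by metis
  have \<omega>: "\<omega> i c z = (\<Sum>j<g. P i j * \<omega>' j c z)" if "i < g" for i c z
    using P[OF that] by (simp add: sum_section_apply)
  define a' where "a' = (\<lambda>k l. if k < g \<and> l < g then \<Sum>i<g. \<Sum>j<g. a i j * P i k * P j l else 0)"
  have sym: "a i j = a j i" for i j using a by (auto simp: I2_def sym2_def)
  have "a' k l = a' l k" for k l
    unfolding a'_def by (subst sum.swap) (simp add: sym mult_ac)
  then have "a' \<in> sym2 g" by (auto simp: sym2_def a'_def)
  have change: "(\<Sum>i<g. \<Sum>j<g. a i j * (\<Sum>k<g. P i k * x k) * (\<Sum>l<g. P j l * y l))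
      = (\<Sum>k<g. \<Sum>l<g. a' k l * x k * y l)" for x y
    unfolding bilinear_change_of_basis by (intro sum.cong refl) (simp add: a'_def)
  have "multiplication_map g \<omega>' a' c z = multiplication_map g \<omega> a c z" for c z
    unfolding multiplication_map_def change[symmetric] by (intro sum.cong refl) (simp add: \<omega>)
  then have "multiplication_map g \<omega>' a' = multiplication_map g \<omega> a" by (simp add: fun_eq_iff)
  then have a': "a' \<in> I2 g \<omega>'" using a \<open>a' \<in> sym2 g\<close> by (simp add: I2_def)
  note sec = canonical_basis_section[OF b] and sec' = canonical_basis_section[OF b']
  have "mu2 A g \<omega> a c z = mu2 A g \<omega>' a' c z" for c z
  proof (cases "c \<in> A \<and> z \<in> snd c ` fst c")
    case True
    then have c: "c \<in> A" "z \<in> snd c ` fst c" by auto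
    have op: "open (snd c ` fst c)" using atl c by (auto simp: holomorphic_atlas_def chart_on_def)
    have d: "deriv (\<omega> i c) z = (\<Sum>j<g. P i j * deriv (\<omega>' j c) z)" if i: "i < g" for i
    proof (rule DERIV_imp_deriv)
      have "(\<omega>' j c has_field_derivative deriv (\<omega>' j c) z) (at z)" if "j < g" for j
      proof (rule holomorphic_derivI[OF _ op c(2)])
        show "\<omega>' j c holomorphic_on snd c ` fst c" using sec'[OF that] c by (auto simp: H0_def)
      qed
      then have "((\<lambda>z. \<Sum>j<g. P i j * \<omega>' j c z) has_field_derivative
          (\<Sum>j<g. P i j * deriv (\<omega>' j c) z)) (at z)"
        by (intro DERIV_sum DERIV_cmult) auto
      moreover have "\<omega> i c = (\<lambda>z. \<Sum>j<g. P i j * \<omega>' j c z)" using \<omega>[OF i] by (rule ext)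
      ultimately show "(\<omega> i c has_field_derivative (\<Sum>j<g. P i j * deriv (\<omega>' j c) z)) (at z)"
        by simp
    qed
    have "(\<Sum>i<g. \<Sum>j<g. a i j * deriv (\<omega> i c) z * deriv (\<omega> j c) z)
        = (\<Sum>k<g. \<Sum>l<g. a' k l * deriv (\<omega>' k c) z * deriv (\<omega>' l c) z)"
      unfolding change[symmetric] by (intro sum.cong refl) (simp add: d)
    then show ?thesis
      using mu2_eq_first_derivatives[OF atl sec a c] mu2_eq_first_derivatives[OF atl sec' a' c]
      by simp
  qed (auto simp: mu2_def)
  then have "s = mu2 A g \<omega>' a'" by (simp add: s fun_eq_iff)
  then show "s \<in> mu2 A g \<omega>' ` I2 g \<omega>'" using a' by blast
qed

section \<open>Quadrics through the rational normal curve\<close>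

definition diagonal :: "nat \<Rightarrow> (nat \<Rightarrow> nat \<Rightarrow> complex) \<Rightarrow> nat \<Rightarrow> complex" where
  "diagonal g b k = (\<Sum>i<g. \<Sum>j<g. if i + j = k then b i j else 0)"

text \<open>
The upper bound \<open>2 * g\<close> exceeds all the values \<open>i + j\<close>; the superfluous diagonals are empty.
\<close>

lemma sum_by_diagonals:
  "(\<Sum>i<g. \<Sum>j<g. b i j * f (i + j)) = (\<Sum>k\<le>2 * g. diagonal g b k * f k)"
proof -
  have "(\<Sum>k\<le>2 * g. diagonal g b k * f k)
      = (\<Sum>k\<le>2 * g. \<Sum>i<g. \<Sum>j<g. if i + j = k then b i j * f k else 0)"
    unfolding diagonal_def sum_distrib_right by (intro sum.cong refl) simp
  also have "\<dots> = (\<Sum>i<g. \<Sum>k\<le>2 * g. \<Sum>j<g. if i + j = k then b i j * f k else 0)"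
    by (rule sum.swap)
  also have "\<dots> = (\<Sum>i<g. \<Sum>j<g. \<Sum>k\<le>2 * g. if i + j = k then b i j * f k else 0)"
    by (intro sum.cong refl sum.swap)
  also have "\<dots> = (\<Sum>i<g. \<Sum>j<g. b i j * f (i + j))"
    by (intro sum.cong refl) simp
  finally show ?thesis by simp
qed

text \<open>
By symmetry the sums of \<open>i a\<^sub>i\<^sub>j\<close> and of \<open>j a\<^sub>i\<^sub>j\<close> over a diagonal are equal, and together they give \<open>k\<close> times
the sum of the entries.
\<close>

lemma diagonal_first_moment:
  assumes sym: "\<And>i j. a i j = a j i" and 0: "diagonal g a k = 0"
  shows "diagonal g (\<lambda>i j. of_nat i * a i j) k = 0" "diagonal g (\<lambda>i j. of_nat j * a i j) k = 0"
proof -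
  have eq: "diagonal g (\<lambda>i j. of_nat j * a i j) k = diagonal g (\<lambda>i j. of_nat i * a i j) k"
    unfolding diagonal_def by (subst sum.swap) (auto intro!: sum.cong simp: sym add.commute)
  have "diagonal g (\<lambda>i j. of_nat i * a i j) k + diagonal g (\<lambda>i j. of_nat j * a i j) k
      = of_nat k * diagonal g a k"
    unfolding diagonal_def sum.distrib[symmetric] sum_distrib_left
    by (intro sum.cong refl) (auto simp: algebra_simps)
  then show "diagonal g (\<lambda>i j. of_nat i * a i j) k = 0"
    "diagonal g (\<lambda>i j. of_nat j * a i j) k = 0"
    using eq 0 by auto
qed

text \<open>
The coefficient of \<open>T\<^bsup>k-2\<^esup>\<close> in the formula \<open>mu2_eta\<close> for the second Gaussian map.
\<close>

definition weight :: "nat \<Rightarrow> (nat \<Rightarrow> nat \<Rightarrow> complex) \<Rightarrow> nat \<Rightarrow> complex" where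
  "weight g a k = diagonal g (\<lambda>i j. of_nat (i * j) * a i j) k"

text \<open>
On each of these diagonals, the entries inside the \<open>g \<times> g\<close> square all have the same product \<open>i j\<close>:
it is \<open>0\<close> for \<open>k < 2\<close>, and \<open>(g - 1) (g - 2)\<close> and \<open>(g - 1)\<^sup>2\<close> for \<open>k = 2g - 3\<close> and \<open>k = 2g - 2\<close>.
\<close>

lemma weight_outside:
  assumes 0: "diagonal g a k = 0" and k: "k \<notin> {2..2 * g - 4}" and g: "g \<ge> 3"
  shows "weight g a k = 0"
proof -
  have "\<exists>C. \<forall>i j. i < g \<longrightarrow> j < g \<longrightarrow> i + j = k \<longrightarrow> i * j = C"
  proof -
    consider "k < 2" | "k = 2 * g - 3" | "k \<ge> 2 * g - 2" using k g by fastforce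
    then show ?thesis
    proof cases
      case 1
      have "i * j = 0" if "i + j = k" for i j using 1 that by (cases i; cases j) auto
      then show ?thesis by blast
    next
      case 2
      have "i * j = (g - 1) * (g - 2)" if "i < g" "j < g" "i + j = k" for i j
      proof -
        have "i = g - 1 \<and> j = g - 2 \<or> i = g - 2 \<and> j = g - 1" using 2 that g by linarith
        then show ?thesis by auto
      qed
      then show ?thesis by blast
    next
      case 3
      have "i * j = (g - 1) * (g - 1)" if "i < g" "j < g" "i + j = k" for i j
      proof -
        have "i = g - 1 \<and> j = g - 1" using 3 that by linarith
        then show ?thesis by simp
      qed
      then show ?thesis by blast
    qed
  qed
  then obtain C where C: "\<And>i j. i < g \<Longrightarrow> j < g \<Longrightarrow> i + j = k \<Longrightarrow> i * j = C" by blast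
  have "weight g a k = of_nat C * diagonal g a k"
    unfolding weight_def diagonal_def sum_distrib_left
    by (intro sum.cong refl) (simp add: C del: of_nat_mult)
  then show ?thesis using 0 by simp
qed

text \<open>
The quadric \<open>2 (x\<^sub>r x\<^sub>s - x\<^sub>i x\<^sub>j)\<close> with \<open>r = i + 1\<close> and \<open>s = j - 1\<close>, one of the equations of the rational
normal curve.  Adding up the four entries also covers the case \<open>j = i + 2\<close>, where two of them
coincide.
\<close>

definition quadric :: "nat \<Rightarrow> nat \<Rightarrow> nat \<Rightarrow> nat \<Rightarrow> complex" where
  "quadric i j r s = of_bool (r = i + 1 \<and> s = j - 1) + of_bool (r = j - 1 \<and> s = i + 1)
     - of_bool (r = i \<and> s = j) - of_bool (r = j \<and> s = i)"

lemma sum_single_entry: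
  fixes f :: "nat \<Rightarrow> nat \<Rightarrow> complex"
  assumes "i < g" "j < g"
  shows "(\<Sum>r<g. \<Sum>s<g. of_bool (r = i \<and> s = j) * f r s) = f i j"
proof -
  have "(\<Sum>r<g. \<Sum>s<g. of_bool (r = i \<and> s = j) * f r s)
      = (\<Sum>r<g. if r = i then (\<Sum>s<g. if s = j then f i j else 0) else 0)"
    by (intro sum.cong refl) (auto intro!: sum.cong sum.neutral)
  then show ?thesis using assms by simp
qed

lemma quadric_sum:
  assumes "i + 2 \<le> j" "j < g"
  shows "(\<Sum>r<g. \<Sum>s<g. quadric i j r s * f r s)
    = f (i + 1) (j - 1) + f (j - 1) (i + 1) - f i j - f j i"
proof -
  have i: "i < g" "i + 1 < g" "j - 1 < g" using assms by auto
  show ?thesis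
    unfolding quadric_def ring_distribs sum.distrib sum_subtractf
    by (simp only: sum_single_entry[OF i(2,3)] sum_single_entry[OF i(3,2)]
        sum_single_entry[OF i(1) assms(2)] sum_single_entry[OF assms(2) i(1)])
qed

text \<open>
The weight is \<open>2 ((i + 1) (j - 1) - i j)\<close>, and \<open>i + 2 \<le> j\<close> makes it positive.
\<close>

lemma weight_quadric:
  assumes "i + 2 \<le> j" "j < g"
  shows "weight g (quadric i j) k = (if k = i + j then 2 * of_nat (j - i - 1) else 0)"
proof -
  have "weight g (quadric i j) k
      = (\<Sum>r<g. \<Sum>s<g. quadric i j r s * (if r + s = k then of_nat (r * s) else 0))"
    unfolding weight_def diagonal_def by (intro sum.cong refl) simp
  also have "\<dots> = (if k = i + j then 2 * (of_nat ((i + 1) * (j - 1)) - of_nat (i * j)) else 0)"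
    unfolding quadric_sum[OF assms] using assms by (auto simp: algebra_simps)
  also have "of_nat ((i + 1) * (j - 1)) - of_nat (i * j) = (of_nat (j - i - 1) :: complex)"
  proof -
    obtain d where "j = i + 2 + d" using assms(1) le_Suc_ex by blast
    then show ?thesis by (simp add: algebra_simps)
  qed
  finally show ?thesis .
qed

lemma power_coefficients_zero:
  fixes a :: "nat \<Rightarrow> complex"
  assumes "infinite S" "\<And>t. t \<in> S \<Longrightarrow> (\<Sum>k\<le>n. a k * t ^ k) = 0" "k \<le> n"
  shows "a k = 0"
proof (rule ccontr)
  assume "a k \<noteq> 0"
  then have "finite {t. (\<Sum>i\<le>n. a i * t ^ i) = 0}"
    using assms(3) polyfun_finite_roots[of a n] by blast
  moreover have "S \<subseteq> {t. (\<Sum>i\<le>n. a i * t ^ i) = 0}" using assms(2) by blast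
  ultimately show False using assms(1) finite_subset by blast
qed

section \<open>The second Gaussian map in a basis of powers\<close>

locale pole_basis = double_cover X A F for X :: "'a topology" and A F +
  fixes q :: complex and g :: nat and \<eta> :: "nat \<Rightarrow> 'a diff_section"
  assumes g3: "g \<ge> 3"
    and eta_section: "i < g \<Longrightarrow> \<eta> i \<in> H0 A 1"
    and eta_power: "i < g \<Longrightarrow> c \<in> A \<Longrightarrow> p \<in> fst c \<Longrightarrow> F p \<noteq> Some q \<Longrightarrow>
      \<eta> i c (snd c p) = pole q p ^ i * \<eta> 0 c (snd c p)"
    and eta_nonzero: "\<eta> 0 \<noteq> 0"
begin

lemma pole_inj: "F x \<noteq> Some q \<Longrightarrow> F y \<noteq> Some q \<Longrightarrow> pole q x = pole q y \<Longrightarrow> F x = F y"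
  by (cases "F x"; cases "F y") (auto simp: pole_def)

text \<open>
Away from the fibre over \<open>q\<close>, the function \<open>T\<close> determines \<open>F\<close>.
\<close>

lemma infinite_pole_values:
  assumes c: "c \<in> A" and D: "open D" "D \<noteq> {}" "D \<subseteq> snd c ` {p \<in> fst c. F p \<noteq> Some q}"
  shows "infinite ((pole q \<circ> chart_inv c) ` D)"
proof
  assume fin: "finite ((pole q \<circ> chart_inv c) ` D)"
  have off: "F (chart_inv c z) \<noteq> Some q" if "z \<in> D" for z
    using D(3) that by (auto simp: chart_inv_left[OF c])
  \<comment> \<open>The map that recovers \<open>F\<close> from \<open>T\<close> on \<open>D\<close>.\<close>
  define h where "h = (\<lambda>t. SOME y. \<exists>z\<in>D. y = F (chart_inv c z) \<and> pole q (chart_inv c z) = t)"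
  have "h (pole q (chart_inv c z)) = F (chart_inv c z)" if z: "z \<in> D" for z
    unfolding h_def
  proof (rule some_equality)
    show "\<exists>z'\<in>D. F (chart_inv c z) = F (chart_inv c z') \<and>
        pole q (chart_inv c z') = pole q (chart_inv c z)"
      using z by blast
  qed (use off z pole_inj in blast)
  then have "F ` chart_inv c ` D = h ` ((pole q \<circ> chart_inv c) ` D)"
    by (simp add: image_image)
  then have "finite (F ` chart_inv c ` D)" using fin by simp
  moreover have "D \<subseteq> snd c ` fst c" using D(3) by blast
  ultimately show False using infinite_values[OF c D(1,2)] by blast
qed

text \<open>
On a disc where \<open>\<eta> 0\<close> has no zero, the derivative of \<open>T\<close> cannot vanish identically, as \<open>T\<close>
takes infinitely many values there.
\<close>

lemma coordinate_patch:
  "\<exists>c\<in>A. \<exists>D. open D \<and> D \<noteq> {} \<and> D \<subseteq> snd c ` {p \<in> fst c. F p \<noteq> Some q} \<and>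
     (\<forall>z\<in>D. \<eta> 0 c z \<noteq> 0 \<and> deriv (pole q \<circ> chart_inv c) z \<noteq> 0)"
proof -
  have sec: "\<eta> 0 \<in> H0 A 1" using eta_section g3 by simp
  obtain c z0 where z0: "\<eta> 0 c z0 \<noteq> 0" using eta_nonzero by (auto simp: fun_eq_iff)
  then have c: "c \<in> A" and z0c: "z0 \<in> snd c ` fst c" using sec unfolding H0_def by blast+
  define \<tau> where "\<tau> = pole q \<circ> chart_inv c"
  define S where "S = snd c ` {p \<in> fst c. F p \<noteq> Some q}"
  have S: "open S" "S \<subseteq> snd c ` fst c" using open_off_fibre[OF c] by (auto simp: S_def)
  have \<tau>: "\<tau> holomorphic_on S" unfolding \<tau>_def S_def by (rule pole_holomorphic[OF c])
  have eta: "\<eta> 0 c holomorphic_on snd c ` fst c" by (rule section_holomorphic[OF sec c])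
  have preimage: "open (U \<inter> f -` (- {0}))" if "f holomorphic_on U" "open U" for U and f :: "complex \<Rightarrow> complex"
    using that by (intro continuous_open_preimage holomorphic_on_imp_continuous_on) auto
  define D1 where "D1 = S \<inter> (snd c ` fst c \<inter> \<eta> 0 c -` (- {0}))"
  have D1: "open D1" unfolding D1_def by (intro open_Int S preimage eta open_chart_range[OF c])
  obtain p0 where p0: "p0 \<in> fst c" "z0 = snd c p0" using z0c by blast
  have "\<forall>\<^sub>F z in at z0. z \<in> (snd c ` fst c \<inter> \<eta> 0 c -` (- {0})) - {z0}"
    using z0 z0c by (intro eventually_at_in_open preimage eta open_chart_range[OF c]) auto
  then have "\<forall>\<^sub>F z in at z0. z \<in> D1"
    using eventually_off_fibre[OF c p0(1), of "Some q", folded p0(2)]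
  proof eventually_elim
    case (elim z)
    then have "z \<in> S" unfolding S_def using chart_inv_in chart_inv_right
      by (metis (mono_tags, lifting) image_eqI mem_Collect_eq)
    then show ?case using elim by (auto simp: D1_def)
  qed
  then obtain z1 where z1: "z1 \<in> D1"
    using eventually_happens[of _ "at z0"] at_neq_bot by blast
  then obtain r where r: "r > 0" "ball z1 r \<subseteq> D1" using D1 openE by blast
  have "\<exists>z\<in>ball z1 r. deriv \<tau> z \<noteq> 0"
  proof (rule ccontr)
    assume "\<not> ?thesis"
    then have d0: "deriv \<tau> z = 0" if "z \<in> ball z1 r" for z using that by blast
    have "(\<tau> has_field_derivative 0) (at z)" if z: "z \<in> ball z1 r" for z
    proof -
      have "z \<in> S" using z r(2) by (auto simp: D1_def)
      from holomorphic_derivI[OF \<tau> S(1) this] show ?thesis using d0[OF z] by simp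
    qed
    then have "\<tau> z = \<tau> z1" if "z \<in> ball z1 r" for z
      using DERIV_zero_connected_constant[of "ball z1 r" "{}" \<tau>] that r(1)
        has_field_derivative_zero_constant[of "ball z1 r" \<tau>]
      by (metis centre_in_ball convex_ball has_field_derivative_at_within)
    then have "\<tau> ` ball z1 r \<subseteq> {\<tau> z1}" by blast
    then have "finite (\<tau> ` ball z1 r)" by (rule finite_subset) simp
    moreover have "infinite (\<tau> ` ball z1 r)" unfolding \<tau>_def
      using r by (intro infinite_pole_values[OF c]) (auto simp: D1_def S_def)
    ultimately show False by blast
  qed
  then obtain z2 where z2: "z2 \<in> ball z1 r" "deriv \<tau> z2 \<noteq> 0" by blast
  define D where "D = D1 \<inter> (S \<inter> deriv \<tau> -` (- {0}))"
  show ?thesis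
  proof (intro bexI[OF _ c] exI[of _ D] conjI ballI)
    show "open D" unfolding D_def
      by (intro open_Int D1 preimage holomorphic_deriv[OF \<tau>] S)
    have "z2 \<in> D1" using z2(1) r(2) by blast
    then have "z2 \<in> D" using z2(2) by (simp add: D_def D1_def)
    then show "D \<noteq> {}" by blast
    show "D \<subseteq> snd c ` {p \<in> fst c. F p \<noteq> Some q}" by (auto simp: D_def S_def)
    show "\<eta> 0 c z \<noteq> 0" "deriv (pole q \<circ> chart_inv c) z \<noteq> 0" if "z \<in> D" for z
      using that by (auto simp: D_def D1_def \<tau>_def)
  qed
qed

text \<open>
A polynomial in \<open>T\<close> that vanishes at the points where \<open>\<eta> 0\<close> and the differential of \<open>T\<close> do not has
infinitely many zeros.  All linear independence statements below are reduced to this one.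
\<close>

lemma pole_polynomial_zero:
  assumes "\<And>c p. c \<in> A \<Longrightarrow> p \<in> fst c \<Longrightarrow> F p \<noteq> Some q \<Longrightarrow> \<eta> 0 c (snd c p) \<noteq> 0 \<Longrightarrow>
      deriv (pole q \<circ> chart_inv c) (snd c p) \<noteq> 0 \<Longrightarrow> (\<Sum>k\<le>n. a k * pole q p ^ k) = 0"
    and k: "k \<le> n"
  shows "a k = 0"
proof -
  obtain c D where c: "c \<in> A" and D: "open D" "D \<noteq> {}" "D \<subseteq> snd c ` {p \<in> fst c. F p \<noteq> Some q}"
    and nz: "\<forall>z\<in>D. \<eta> 0 c z \<noteq> 0 \<and> deriv (pole q \<circ> chart_inv c) z \<noteq> 0"
    using coordinate_patch by (elim bexE exE conjE) (rule that)
  show ?thesis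
  proof (rule power_coefficients_zero[OF infinite_pole_values[OF c D] _ k])
    fix t assume "t \<in> (pole q \<circ> chart_inv c) ` D"
    then obtain z where z: "z \<in> D" "t = pole q (chart_inv c z)" by auto
    then obtain p where p: "p \<in> fst c" "F p \<noteq> Some q" "z = snd c p" using D(3) by blast
    then show "(\<Sum>k\<le>n. a k * t ^ k) = 0"
      using assms(1)[OF c p(1,2)] bspec[OF nz z(1)] z(2) by (simp add: chart_inv_left[OF c])
  qed
qed

lemma eta_independent:
  assumes "(\<Sum>i<g. scale_section (u i) (\<eta> i)) = 0" "i < g"
  shows "u i = 0"
proof (rule pole_polynomial_zero)
  show "i \<le> g - 1" using assms(2) by simp
  fix c p assume cp: "c \<in> A" "p \<in> fst c" "F p \<noteq> Some q" "\<eta> 0 c (snd c p) \<noteq> 0"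
  have "{..g - 1} = {..<g}" using assms(2) by auto
  then have "(\<Sum>k\<le>g - 1. u k * pole q p ^ k) * \<eta> 0 c (snd c p)
      = (\<Sum>i<g. u i * \<eta> i c (snd c p))"
    unfolding sum_distrib_right by (auto intro!: sum.cong simp: eta_power[OF _ cp(1-3), symmetric] mult.assoc)
  also have "\<dots> = (\<Sum>i<g. scale_section (u i) (\<eta> i)) c (snd c p)"
    by (simp add: sum_section_apply)
  finally show "(\<Sum>k\<le>g - 1. u k * pole q p ^ k) = 0" using assms(1) cp(4) by simp
qed

lemma eta_basis:
  assumes "canonical_basis A g \<omega>"
  shows "canonical_basis A g \<eta>"
proof -
  have ind: "inj_on \<eta> {..<g}" "sections.independent (\<eta> ` {..<g})"
    by (rule sections.independent_family[of "{..<g}" \<eta>]; use eta_independent in simp)+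
  have "sections.span (\<eta> ` {..<g}) = sections.span (\<omega> ` {..<g})"
  proof (rule sections.span_eq_of_card)
    show "card (\<omega> ` {..<g}) \<le> card (\<eta> ` {..<g})"
      using ind(1) assms by (simp add: canonical_basis_def card_image)
    show "\<eta> ` {..<g} \<subseteq> sections.span (\<omega> ` {..<g})"
      using eta_section assms by (auto simp: canonical_basis_def)
  qed (use ind in simp_all)
  then show ?thesis using ind assms by (simp add: canonical_basis_def)
qed

lemma multiplication_map_eta:
  assumes "c \<in> A" "p \<in> fst c" "F p \<noteq> Some q"
  shows "multiplication_map g \<eta> a c (snd c p)
    = \<eta> 0 c (snd c p) ^ 2 * (\<Sum>k\<le>2 * g. diagonal g a k * pole q p ^ k)"
proof -
  have "multiplication_map g \<eta> a c (snd c p)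
      = \<eta> 0 c (snd c p) ^ 2 * (\<Sum>i<g. \<Sum>j<g. a i j * pole q p ^ (i + j))"
    unfolding multiplication_map_def sum_distrib_left
  proof (intro sum.cong refl)
    fix i j assume "i \<in> {..<g}" "j \<in> {..<g}"
    then have "i < g" "j < g" by auto
    note e = this[THEN eta_power[OF _ assms]]
    show "a i j * \<eta> i c (snd c p) * \<eta> j c (snd c p)
        = \<eta> 0 c (snd c p) ^ 2 * (a i j * pole q p ^ (i + j))"
      unfolding e(1) e(2) by (simp add: power_add power2_eq_square mult_ac)
  qed
  then show ?thesis by (simp add: sum_by_diagonals)
qed

lemma I2_diagonal_zero:
  assumes a: "a \<in> I2 g \<eta>" and k: "k \<le> 2 * g"
  shows "diagonal g a k = 0"
proof (rule pole_polynomial_zero[OF _ k])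
  fix c p assume cp: "c \<in> A" "p \<in> fst c" "F p \<noteq> Some q" "\<eta> 0 c (snd c p) \<noteq> 0"
  have "multiplication_map g \<eta> a c (snd c p) = 0" using a by (simp add: I2_def)
  then show "(\<Sum>k\<le>2 * g. diagonal g a k * pole q p ^ k) = 0"
    using multiplication_map_eta[OF cp(1-3)] cp(4) by simp
qed

text \<open>
With \<open>\<eta>\<^sub>i = T\<^bsup>i\<^esup> f\<close>, the product \<open>\<eta>\<^sub>i' \<eta>\<^sub>j'\<close> has the terms \<open>i j T\<^bsup>i+j-2\<^esup> (T' f)\<^sup>2\<close>, \<open>(i + j) T\<^bsup>i+j-1\<^esup> T' f f'\<close> and
\<open>T\<^bsup>i+j\<^esup> f'\<^sup>2\<close>.  The last two contribute nothing, since the sums of \<open>a\<^sub>i\<^sub>j\<close> and their first moments over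
the diagonals are zero.  The truncated exponent \<open>k - 2\<close> is harmless: for \<open>k < 2\<close> the weight is zero.
\<close>

lemma mu2_eta:
  assumes a: "a \<in> I2 g \<eta>" and c: "c \<in> A" and p: "p \<in> fst c" "F p \<noteq> Some q"
  shows "mu2 A g \<eta> a c (snd c p)
    = - ((deriv (pole q \<circ> chart_inv c) (snd c p) * \<eta> 0 c (snd c p)) ^ 2)
        * (\<Sum>k\<le>2 * g. weight g a k * pole q p ^ (k - 2))"
proof -
  define z where "z = snd c p"
  define t where "t = pole q p"
  define t' where "t' = deriv (pole q \<circ> chart_inv c) z"
  define f where "f = \<eta> 0 c z"
  define f' where "f' = deriv (\<eta> 0 c) z"
  define S where "S = snd c ` {p \<in> fst c. F p \<noteq> Some q}"
  have S: "open S" "z \<in> S" using open_off_fibre[OF c] p by (auto simp: S_def z_def)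
  have zc: "z \<in> snd c ` fst c" using p by (simp add: z_def)
  have dt: "((pole q \<circ> chart_inv c) has_field_derivative t') (at z)"
    unfolding t'_def
    by (rule holomorphic_derivI[OF pole_holomorphic[OF c, of q, folded S_def] S])
  have df: "(\<eta> 0 c has_field_derivative f') (at z)"
    unfolding f'_def
    using holomorphic_derivI[OF section_holomorphic[OF eta_section c] open_chart_range[OF c] zc] g3
    by simp
  have tz: "pole q (chart_inv c z) = t" by (simp add: z_def t_def chart_inv_left[OF c p(1)])
  have d: "deriv (\<eta> i c) z = of_nat i * t ^ (i - 1) * t' * f + t ^ i * f'" if i: "i < g" for i
  proof (rule DERIV_imp_deriv)
    have "((\<lambda>x. (pole q \<circ> chart_inv c) x ^ i * \<eta> 0 c x) has_field_derivative
        of_nat i * t ^ (i - 1) * t' * f + t ^ i * f') (at z)"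
      using DERIV_mult[OF DERIV_power[OF dt, of i] df]
      by (simp add: tz f_def mult_ac)
    then show "(\<eta> i c has_field_derivative of_nat i * t ^ (i - 1) * t' * f + t ^ i * f') (at z)"
    proof (rule has_field_derivative_transform_within_open[OF _ S])
      fix x assume "x \<in> S"
      then show "(pole q \<circ> chart_inv c) x ^ i * \<eta> 0 c x = \<eta> i c x"
        using eta_power[OF i c] by (auto simp: S_def chart_inv_left[OF c])
    qed
  qed
  have product: "(of_nat i * t ^ (i - 1) * t' * f + t ^ i * f') * (of_nat j * t ^ (j - 1) * t' * f + t ^ j * f')
      = (t' * f) ^ 2 * (of_nat (i * j) * t ^ (i + j - 2)) + t' * f * f' * (of_nat i * t ^ (i + j - 1))
        + t' * f * f' * (of_nat j * t ^ (i + j - 1)) + f' ^ 2 * t ^ (i + j)" for i j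
    by (cases i; cases j) (simp_all add: algebra_simps power2_eq_square power_add)
  have sym: "a i j = a j i" for i j using a by (auto simp: I2_def sym2_def)
  have vanish: "(\<Sum>i<g. \<Sum>j<g. b i j * h (i + j)) = 0"
    if "\<And>k. k \<le> 2 * g \<Longrightarrow> diagonal g b k = 0" for b h
    using that by (simp add: sum_by_diagonals)
  have zero: "(\<Sum>i<g. \<Sum>j<g. a i j * t ^ (i + j)) = 0"
    "(\<Sum>i<g. \<Sum>j<g. of_nat i * a i j * t ^ (i + j - 1)) = 0"
    "(\<Sum>i<g. \<Sum>j<g. of_nat j * a i j * t ^ (i + j - 1)) = 0"
    by (rule vanish[of a "\<lambda>k. t ^ k"]
        vanish[of "\<lambda>i j. of_nat i * a i j" "\<lambda>k. t ^ (k - 1)"]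
        vanish[of "\<lambda>i j. of_nat j * a i j" "\<lambda>k. t ^ (k - 1)"],
        erule I2_diagonal_zero[OF a] diagonal_first_moment[OF sym I2_diagonal_zero[OF a]])+
  have "(\<Sum>i<g. \<Sum>j<g. a i j * deriv (\<eta> i c) z * deriv (\<eta> j c) z)
      = (\<Sum>i<g. \<Sum>j<g. (t' * f) ^ 2 * (of_nat (i * j) * a i j * t ^ (i + j - 2))
        + t' * f * f' * (of_nat i * a i j * t ^ (i + j - 1))
        + t' * f * f' * (of_nat j * a i j * t ^ (i + j - 1)) + f' ^ 2 * (a i j * t ^ (i + j)))"
  proof (intro sum.cong refl)
    fix i j assume "i \<in> {..<g}" "j \<in> {..<g}"
    then have "a i j * deriv (\<eta> i c) z * deriv (\<eta> j c) z
        = a i j * ((of_nat i * t ^ (i - 1) * t' * f + t ^ i * f') * (of_nat j * t ^ (j - 1) * t' * f + t ^ j * f'))"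
      by (simp add: d mult.assoc)
    then show "a i j * deriv (\<eta> i c) z * deriv (\<eta> j c) z
        = (t' * f) ^ 2 * (of_nat (i * j) * a i j * t ^ (i + j - 2))
        + t' * f * f' * (of_nat i * a i j * t ^ (i + j - 1))
        + t' * f * f' * (of_nat j * a i j * t ^ (i + j - 1)) + f' ^ 2 * (a i j * t ^ (i + j))"
      unfolding product by (simp add: algebra_simps)
  qed
  also have "\<dots> = (t' * f) ^ 2 * (\<Sum>i<g. \<Sum>j<g. of_nat (i * j) * a i j * t ^ (i + j - 2))"
    unfolding sum.distrib sum_distrib_left[symmetric] zero by simp
  also have "(\<Sum>i<g. \<Sum>j<g. of_nat (i * j) * a i j * t ^ (i + j - 2))
      = (\<Sum>k\<le>2 * g. weight g a k * t ^ (k - 2))"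
    unfolding weight_def
    by (rule sum_by_diagonals[of "\<lambda>i j. of_nat (i * j) * a i j" "\<lambda>k. t ^ (k - 2)"])
  finally show ?thesis
    using mu2_eq_first_derivatives[OF atlas eta_section a c zc]
    by (simp add: z_def t_def t'_def f_def)
qed

lemma quadric_in_I2:
  assumes ij: "i + 2 \<le> j" "j < g"
  shows "quadric i j \<in> I2 g \<eta>"
proof -
  have mult: "multiplication_map g \<eta> (quadric i j) c z = 0" for c z
  proof (cases "c \<in> A \<and> z \<in> snd c ` fst c")
    case False
    have "\<eta> r c z = 0" if "r < g" for r
      using eta_section[OF that] False unfolding H0_def by blast
    then show ?thesis by (simp add: multiplication_map_def)
  next
    case True
    then obtain p where c: "c \<in> A" and p: "p \<in> fst c" "z = snd c p" by blast
    have "multiplication_map g \<eta> (quadric i j) c (snd c p) = (\<lambda>_. 0) (snd c p)"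
    proof (rule chart_eq_off_fibre[OF c, of "fst c"])
      show "continuous_on (snd c ` fst c) (multiplication_map g \<eta> (quadric i j) c)"
        unfolding multiplication_map_def
        by (intro continuous_intros holomorphic_on_imp_continuous_on
            section_holomorphic[OF eta_section c]) auto
      fix x assume x: "x \<in> fst c" "F x \<noteq> Some q"
      have "(\<Sum>r<g. \<Sum>s<g. quadric i j r s * pole q x ^ (r + s)) = 0"
        using ij by (simp only: quadric_sum) (simp add: add.commute)
      then show "multiplication_map g \<eta> (quadric i j) c (snd c x) = 0"
        unfolding multiplication_map_eta[OF c x] sum_by_diagonals by simp
    qed (use p c chart_openin in auto)
    then show ?thesis by (simp add: p(2))
  qed
  have "quadric i j r s = quadric i j s r" for r s
    unfolding quadric_def by (simp add: conj_commute add.commute)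
  moreover have "quadric i j r s = 0" if "r \<ge> g \<or> s \<ge> g" for r s
  proof -
    have "\<not> (r = i + 1 \<and> s = j - 1)" "\<not> (r = j - 1 \<and> s = i + 1)" "\<not> (r = i \<and> s = j)"
      "\<not> (r = j \<and> s = i)"
      using that ij by auto
    then show ?thesis unfolding quadric_def by (simp only: of_bool_eq) simp
  qed
  ultimately have "quadric i j \<in> sym2 g" by (simp add: sym2_def)
  moreover note mult
  ultimately show ?thesis by (simp add: I2_def fun_eq_iff)
qed

lemma section_eq_off_fibre:
  assumes s: "s \<in> H0 A n" and t: "t \<in> H0 A n"
    and eq: "\<And>c p. c \<in> A \<Longrightarrow> p \<in> fst c \<Longrightarrow> F p \<noteq> Some q \<Longrightarrow> s c (snd c p) = t c (snd c p)"
  shows "s = t"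
proof -
  have "s c z = t c z" for c z
  proof (cases "c \<in> A \<and> z \<in> snd c ` fst c")
    case False
    then show ?thesis using s t unfolding H0_def by (metis (mono_tags, lifting) mem_Collect_eq)
  next
    case True
    then obtain p where c: "c \<in> A" and p: "p \<in> fst c" "z = snd c p" by blast
    have "s c (snd c p) = t c (snd c p)"
    proof (rule chart_eq_off_fibre[OF c, where U = "fst c" and q = q])
      show "continuous_on (snd c ` fst c) (s c)" "continuous_on (snd c ` fst c) (t c)"
        by (intro holomorphic_on_imp_continuous_on section_holomorphic[OF s c]
            section_holomorphic[OF t c])+
    qed (use p c chart_openin eq in auto)
    then show ?thesis by (simp add: p(2))
  qed
  then show ?thesis by (simp add: fun_eq_iff)
qed

text \<open>
The quadric on the diagonal \<open>i + j = k\<close> with the longest possible span: \<open>i = max 0 (k - (g - 1))\<close>,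
written by truncated subtraction, and \<open>j = k - i\<close>.
\<close>

definition standard_quadric :: "nat \<Rightarrow> nat \<Rightarrow> nat \<Rightarrow> complex" where
  "standard_quadric k = quadric (k - (g - 1)) (k - (k - (g - 1)))"

definition standard_weight :: "nat \<Rightarrow> complex" where
  "standard_weight k = 2 * of_nat (k - (k - (g - 1)) - (k - (g - 1)) - 1)"

lemma standard_quadric:
  assumes k: "k \<in> {2..2 * g - 4}"
  shows "standard_quadric k \<in> I2 g \<eta>" "standard_weight k \<noteq> 0"
    "weight g (standard_quadric k) l = (if l = k then standard_weight k else 0)"
proof -
  define i where "i = k - (g - 1)"
  define j where "j = k - i"
  have ij: "i + 2 \<le> j" "j < g" "i + j = k" using k g3 by (auto simp: i_def j_def)
  have "j - i - 1 > 0" using ij(1) by simp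
  then show "standard_weight k \<noteq> 0"
    unfolding standard_weight_def i_def[symmetric] j_def[symmetric]
    by (metis mult_eq_0_iff of_nat_eq_0_iff less_numeral_extra(3) zero_neq_numeral)
  show "standard_quadric k \<in> I2 g \<eta>"
    unfolding standard_quadric_def i_def[symmetric] j_def[symmetric]
    by (rule quadric_in_I2[OF ij(1,2)])
  show "weight g (standard_quadric k) l = (if l = k then standard_weight k else 0)"
    unfolding standard_quadric_def standard_weight_def i_def[symmetric] j_def[symmetric]
      weight_quadric[OF ij(1,2)] ij(3) ..
qed

lemma mu2_standard_quadric:
  assumes k: "k \<in> {2..2 * g - 4}" and c: "c \<in> A" and p: "p \<in> fst c" "F p \<noteq> Some q"
  shows "mu2 A g \<eta> (standard_quadric k) c (snd c p)
    = - ((deriv (pole q \<circ> chart_inv c) (snd c p) * \<eta> 0 c (snd c p)) ^ 2)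
        * (standard_weight k * pole q p ^ (k - 2))"
proof -
  have "(\<Sum>l\<le>2 * g. weight g (standard_quadric k) l * pole q p ^ (l - 2))
      = (\<Sum>l\<le>2 * g. if l = k then standard_weight k * pole q p ^ (k - 2) else 0)"
    by (intro sum.cong refl) (simp add: standard_quadric(3)[OF k])
  also have "k \<le> 2 * g" using k by auto
  then have "(\<Sum>l\<le>2 * g. if l = k then standard_weight k * pole q p ^ (k - 2) else 0)
      = standard_weight k * pole q p ^ (k - 2)" by simp
  finally show ?thesis using mu2_eta[OF standard_quadric(1)[OF k] c p] by simp
qed

text \<open>
Away from the fibre over \<open>q\<close> both sides are the same combination of the functions
\<open>(T' \<eta>\<^sub>0)\<^sup>2 T\<^bsup>k-2\<^esup>\<close>, and sections that agree there are equal.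
\<close>

lemma mu2_in_span:
  assumes a: "a \<in> I2 g \<eta>"
  shows "mu2 A g \<eta> a
    = (\<Sum>k\<in>{2..2 * g - 4}. scale_section (weight g a k / standard_weight k)
        (mu2 A g \<eta> (standard_quadric k)))"
proof (rule section_eq_off_fibre)
  show "mu2 A g \<eta> a \<in> H0 A 4" by (rule mu2_in_H0[OF atlas eta_section a])
  show "(\<Sum>k\<in>{2..2 * g - 4}. scale_section (weight g a k / standard_weight k)
        (mu2 A g \<eta> (standard_quadric k))) \<in> H0 A 4"
    by (intro sections.subspace_sum sections.subspace_scale sections_subspace_H0
        mu2_in_H0[OF atlas eta_section] standard_quadric(1))
  fix c p assume cp: "c \<in> A" "p \<in> fst c" "F p \<noteq> Some q"
  let ?C = "- ((deriv (pole q \<circ> chart_inv c) (snd c p) * \<eta> 0 c (snd c p)) ^ 2)"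
  have "(\<Sum>k\<le>2 * g. weight g a k * pole q p ^ (k - 2))
      = (\<Sum>k\<in>{2..2 * g - 4}. weight g a k * pole q p ^ (k - 2))"
    using weight_outside[OF I2_diagonal_zero[OF a] _ g3]
    by (intro sum.mono_neutral_right) auto
  then have "mu2 A g \<eta> a c (snd c p) = (\<Sum>k\<in>{2..2 * g - 4}. ?C * (weight g a k * pole q p ^ (k - 2)))"
    using mu2_eta[OF a cp] by (simp add: sum_distrib_left)
  also have "\<dots> = (\<Sum>k\<in>{2..2 * g - 4}. weight g a k / standard_weight k
        * mu2 A g \<eta> (standard_quadric k) c (snd c p))"
    by (intro sum.cong refl) (simp add: mu2_standard_quadric[OF _ cp] standard_quadric(2))
  finally show "mu2 A g \<eta> a c (snd c p)
      = (\<Sum>k\<in>{2..2 * g - 4}. scale_section (weight g a k / standard_weight k)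
        (mu2 A g \<eta> (standard_quadric k))) c (snd c p)"
    by (simp add: sum_section_apply)
qed

lemma mu2_independent:
  assumes 0: "(\<Sum>k\<in>{2..2 * g - 4}. scale_section (u k) (mu2 A g \<eta> (standard_quadric k))) = 0"
    and k: "k \<in> {2..2 * g - 4}"
  shows "u k = 0"
proof -
  define b where "b = (\<lambda>l. u (l + 2) * standard_weight (l + 2))"
  have "b (k - 2) = 0"
  proof (rule pole_polynomial_zero)
    show "k - 2 \<le> 2 * g - 6" using k by auto
    fix c p assume cp: "c \<in> A" "p \<in> fst c" "F p \<noteq> Some q"
      and nz: "\<eta> 0 c (snd c p) \<noteq> 0" "deriv (pole q \<circ> chart_inv c) (snd c p) \<noteq> 0"
    let ?C = "- ((deriv (pole q \<circ> chart_inv c) (snd c p) * \<eta> 0 c (snd c p)) ^ 2)"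
    have "?C * (\<Sum>l\<le>2 * g - 6. b l * pole q p ^ l)
        = ?C * (\<Sum>k\<in>{2..2 * g - 4}. u k * standard_weight k * pole q p ^ (k - 2))"
    proof -
      have Suc_Suc: "Suc (Suc (a - 2)) = a" if "2 \<le> a" for a using that by auto
      have "(\<Sum>k\<in>{2..2 * g - 4}. u k * standard_weight k * pole q p ^ (k - 2))
          = (\<Sum>l\<in>{0..2 * g - 6}. b l * pole q p ^ l)"
        by (rule sum.reindex_bij_witness[of _ "\<lambda>l. l + 2" "\<lambda>k. k - 2"])
          (use g3 in \<open>auto simp: b_def Suc_Suc\<close>)
      then show ?thesis by (simp add: atMost_atLeast0)
    qed
    also have "\<dots> = (\<Sum>k\<in>{2..2 * g - 4}. u k * mu2 A g \<eta> (standard_quadric k) c (snd c p))"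
      unfolding sum_distrib_left
      by (intro sum.cong refl) (simp add: mu2_standard_quadric[OF _ cp])
    also have "\<dots> = (\<Sum>k\<in>{2..2 * g - 4}. scale_section (u k) (mu2 A g \<eta> (standard_quadric k))) c (snd c p)"
      by (simp add: sum_section_apply)
    finally show "(\<Sum>l\<le>2 * g - 6. b l * pole q p ^ l) = 0" using nz 0 by simp
  qed
  moreover have "k - 2 + 2 = k" using k by (intro le_add_diff_inverse2) simp
  ultimately show ?thesis using standard_quadric(2)[OF k] by (simp add: b_def)
qed

lemma dim_mu2: "sections.dim (mu2 A g \<eta> ` I2 g \<eta>) = 2 * g - 5"
proof -
  define v where "v = (\<lambda>k. mu2 A g \<eta> (standard_quadric k))"
  let ?K = "{2..2 * g - 4}"
  have ind: "inj_on v ?K" "sections.independent (v ` ?K)"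
    by (rule sections.independent_family[of ?K v]; use mu2_independent in \<open>simp add: v_def\<close>)+
  have "card (v ` ?K) = sections.dim (mu2 A g \<eta> ` I2 g \<eta>)"
  proof (rule sections.basis_card_eq_dim[OF _ _ ind(2)])
    show "v ` ?K \<subseteq> mu2 A g \<eta> ` I2 g \<eta>" using standard_quadric(1) by (auto simp: v_def)
    show "mu2 A g \<eta> ` I2 g \<eta> \<subseteq> sections.span (v ` ?K)"
    proof (rule image_subsetI)
      fix a assume "a \<in> I2 g \<eta>"
      from mu2_in_span[OF this] show "mu2 A g \<eta> a \<in> sections.span (v ` ?K)"
        unfolding v_def
        by (simp only:) (intro sections.span_sum sections.span_scale sections.span_base imageI)
    qed
  qed
  then show ?thesis using ind(1) g3 by (simp add: card_image)
qed

end

theorem proposition4p2: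
  fixes X :: "'a topology" and A :: "'a chart set" and g :: nat
    and \<omega> :: "nat \<Rightarrow> 'a diff_section"
  assumes "hyperelliptic X A"
    and "genus A = g" and "g \<ge> 3"
    and "canonical_basis A g \<omega>"
  shows "sections.dim (mu2 A g \<omega> ` I2 g \<omega>) = 2 * g - 5"
proof -
  have X: "compact_riemann_surface X A" using assms(1) by (simp add: hyperelliptic_def)
  then have atl: "holomorphic_atlas X A" by (simp add: compact_riemann_surface_def)
  obtain F where F: "holomorphic_map X A P1_top P1_atlas F" "has_degree X A P1_top P1_atlas F 2"
    using assms(1) by (auto simp: hyperelliptic_def)
  interpret double_cover X A F
    using X F by unfold_locales (auto simp: compact_riemann_surface_def)
  obtain q where q: "q \<notin> branch_values"
    using finite_branch_values infinite_UNIV_char_0 ex_new_if_finite by blast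
  have "g \<ge> 1" using assms(3) by simp
  from exists_multiple[OF q assms(4) this]
  obtain s where s: "s \<in> multiples q (g - 1)" "s \<noteq> 0" by blast
  then have "\<exists>t. times_power q i s t" if "i < g" for i using that by (auto simp: multiples_def)
  then obtain t where t: "\<And>i. i < g \<Longrightarrow> times_power q i s (t i)" by metis
  \<comment> \<open>The choice of \<open>t 0\<close> is only known to agree with \<open>s\<close> away from the fibre over \<open>q\<close>.\<close>
  define \<eta> where "\<eta> = t(0 := s)"
  have "times_power q i s (\<eta> i)" if "i < g" for i
    using t[OF that] s(1) by (cases i) (auto simp: \<eta>_def times_power_def multiples_def)
  then interpret pole_basis X A F q g \<eta>
    using assms(3) s(2) by unfold_locales (auto simp: times_power_def \<eta>_def)
  have "mu2 A g \<omega> ` I2 g \<omega> = mu2 A g \<eta> ` I2 g \<eta>"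
    using mu2_image_subset[OF atl assms(4) eta_basis[OF assms(4)]]
      mu2_image_subset[OF atl eta_basis[OF assms(4)] assms(4)] by (rule subset_antisym)
  then show ?thesis using dim_mu2 by simp
qed

end
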